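(* (1) Let $\ell_m$ be the minimal $n$ such that $\langle \underbrace{1,\dots,1}_{n}\rangle_m$ is universal. Then $\ell_m=m-4$ if $m\ge 9$; $\ell_m=3$ if $m\in\{3,5,6\}$; and $\ell_m=4$ if $m\in\{4,7,8\}$. (2) For $5\le r<m-3$, $\ell_{m,r,r-1}=\lceil \frac{m-3}{r}\rceil+(r-2)$. (3) $\ell_{m,2,1}=\lfloor \frac m2\rfloor$ for $m\ge 12$; $\ell_{m,3,2}=m-2$ for $m\ge 10$ with $m\not\equiv 2\pmod 3$, and $\ell_{m,3,2}=\frac{2m-4}{3}$ for $m\ge 14$ with $m\equiv2\pmod 3$; and $\ell_{m,4,3}=\lceil\frac{m-2}{4}\rceil+2$ for $m\ge 62$.
   Context: For $m\ge 3$ and $x\in\mathbb Z$, $P_m(x)=\frac{m-2}{2}x^2-\frac{m-4}{2}x$. The form $\langle a_1,\dots,a_n\rangle_m$ is $a_1P_m(x_1)+\cdots+a_nP_m(x_n)$ with $x_k\in\mathbb Z$; it is universal if it represents (takes the value of) every positive integer. For $2\le r<m-4$, $\ell_{m,r,r-1}$ denotes the minimal rank $n$ (total number of variables) for which the form $\langle 1,\dots,1,r,\dots,r\rangle_m$ with exactly $r-1$ coefficients equal to $1$ and the remaining $n-(r-1)$ coefficients equal to $r$ is universal. *)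

theory Defs
  imports Complex_Main "HOL-Library.Extended_Nat"
begin

(* The numerator is always even, so div is exact division: see real_polygonal. *)
definition polygonal :: "nat \<Rightarrow> int \<Rightarrow> int" where
  "polygonal m x = ((int m - 2) * x\<^sup>2 - (int m - 4) * x) div 2"

lemma real_polygonal:
  "real_of_int (polygonal m x) = (real m - 2) / 2 * (real_of_int x)\<^sup>2 - (real m - 4) / 2 * real_of_int x"
proof -
  have "even ((int m - 2) * x\<^sup>2 - (int m - 4) * x)"
    by simp
  then have "2 * polygonal m x = (int m - 2) * x\<^sup>2 - (int m - 4) * x"
    unfolding polygonal_def by (rule dvd_mult_div_cancel)
  then have "real_of_int (2 * polygonal m x) = real_of_int ((int m - 2) * x\<^sup>2 - (int m - 4) * x)"
    by simp
  then show ?thesis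
    by (simp add: field_simps)
qed

(* The list as holds the coefficients of the form; its length is the rank. *)
definition represents :: "nat \<Rightarrow> nat list \<Rightarrow> int \<Rightarrow> bool" where
  "represents m as N \<longleftrightarrow>
     (\<exists>x :: nat \<Rightarrow> int. N = (\<Sum>k<length as. int (as ! k) * polygonal m (x k)))"

definition universal :: "nat \<Rightarrow> nat list \<Rightarrow> bool" where
  "universal m as \<longleftrightarrow> (\<forall>N>0. represents m as N)"

(* Minimal ranks are taken in enat, so that the value is infinity if no rank works; an equation
   "minimal rank = enat n" therefore includes the universality of the form of rank n. *)
definition ell :: "nat \<Rightarrow> enat" where
  "ell m = Inf {enat n | n. universal m (replicate n 1)}"

(* s coefficients 1 and the remaining n - s coefficients r; n is the total number of variables. *)
definition ell_ones :: "nat \<Rightarrow> nat \<Rightarrow> nat \<Rightarrow> enat" where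
  "ell_ones m r s =
     Inf {enat n | n. s \<le> n \<and> universal m (replicate s 1 @ replicate (n - s) r)}"

end

theory Submission
  imports Defs
begin

text \<open>
  The upper bounds rest on Cauchy's lemma: if \<open>a\<close>, \<open>b\<close> are odd and \<open>b\<^sup>2 < 4 * a\<close>, then there are four
  integers with sum \<open>b\<close> and sum of squares \<open>a\<close>. Hence four polygonal numbers represent
  \<open>(m - 2) * c + b\<close> for all odd \<open>b\<close> with \<open>(b - 2)\<^sup>2 < 8 * c + 4\<close>; for \<open>c \<ge> 1\<close> this includes
  \<open>b = -1, 1, 3, 5\<close>, and variables restricted to 0 and 1 fill the gaps between these values. The lower
  bounds come from one small integer each, where almost all variables are forced into \<open>{0, 1}\<close>.

  Cauchy's lemma needs Gauss's theorem that every \<open>M = 8 * n + 3\<close> is a sum of three odd squares. Let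
  \<open>s M\<close> count these representations and let \<open>t M\<close> count the positive odd solutions of
  \<open>a * b + b * c + c * a = M\<close> with \<open>a\<close>, \<open>b\<close>, \<open>c\<close> congruent modulo 4. Both functions satisfy the
  recursion \<open>(\<Sum>w odd. (u - w\<^sup>2) * f (4 * u - w\<^sup>2)) = 0\<close>, which determines \<open>f\<close> from \<open>f 3\<close>. So \<open>s\<close> and
  \<open>t\<close> are proportional, and \<open>t M > 0\<close> because of the solution \<open>(1, 1, 4 * n + 1)\<close>. For \<open>s\<close> the recursion
  is the symmetry of \<open>a\<^sup>2 + b\<^sup>2 + c\<^sup>2 + w\<^sup>2 = 4 * u\<close>; for \<open>t\<close> it follows from a chain of sign-reversing
  linear substitutions.
\<close>

section \<open>Sums of three odd squares\<close>

type_synonym int4 = "int \<times> int \<times> int \<times> int"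

text \<open>Fibred over \<open>w\<close>, this is the union of the solution sets counted by
  \<open>t (4 * u - w\<^sup>2)\<close>, so that the recursion becomes one finite weighted sum. The
  congruences make \<open>b\<close> and \<open>c\<close> odd as well.\<close>

definition tri_set :: "int \<Rightarrow> int4 set" where
  "tri_set u = {(a, b, c, w). 0 < a \<and> 0 < b \<and> 0 < c \<and> odd a \<and> odd w \<and>
     4 dvd (a - b) \<and> 4 dvd (b - c) \<and> a * b + b * c + c * a + w\<^sup>2 = 4 * u}"

text \<open>
  The coordinates \<open>2 * q = a - w\<close>, \<open>2 * g = b + w\<close>, \<open>2 * v = b + c\<close>, \<open>2 * h = c + w\<close> turn the equation of
  \<open>tri_set\<close> into \<open>q * v + g * h = u\<close>; the three strict inequalities are \<open>a, b, c > 0\<close>.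
\<close>

definition det_set :: "int \<Rightarrow> int4 set" where
  "det_set u = {(q, v, g, h). q * v + g * h = u \<and> odd v \<and> even (g - h) \<and> odd (g + q) \<and>
     v < g + h + 2 * q \<and> h - g < v \<and> g - h < v}"

lemma abs_le_square_int: "\<bar>w\<bar> \<le> w\<^sup>2" for w :: int
proof (cases "w = 0")
  case False
  then have "\<bar>w\<bar> * 1 \<le> \<bar>w\<bar> * \<bar>w\<bar>" by (intro mult_left_mono) auto
  then show ?thesis by (simp add: power2_eq_square)
qed simp

lemma finite_tri_set: "finite (tri_set u)"
proof (rule finite_subset)
  show "tri_set u \<subseteq> {0..4*u} \<times> {0..4*u} \<times> {0..4*u} \<times> {-(4*u)..4*u}"
  proof
    fix z assume "z \<in> tri_set u"
    then obtain a b c w where z: "z = (a, b, c, w)" and pos: "0 < a" "0 < b" "0 < c"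
      and eq: "a * b + b * c + c * a + w\<^sup>2 = 4 * u" by (auto simp: tri_set_def)
    have 1: "a * 1 \<le> a * b" "b * 1 \<le> b * c" "c * 1 \<le> c * a"
      using pos by (intro mult_left_mono; simp)+
    have 2: "0 \<le> w\<^sup>2" by simp
    have 3: "\<bar>w\<bar> \<le> w\<^sup>2" by (rule abs_le_square_int)
    have "a \<le> 4 * u" "b \<le> 4 * u" "c \<le> 4 * u" "w \<le> 4 * u" "- (4 * u) \<le> w"
      using 1 2 3 eq pos by linarith+
    then show "z \<in> {0..4*u} \<times> {0..4*u} \<times> {0..4*u} \<times> {-(4*u)..4*u}"
      using pos z by auto
  qed
qed auto

abbreviation det_to_tri :: "int4 \<Rightarrow> int4" where
  "det_to_tri \<equiv> \<lambda>(q, v, g, h). (2 * q + g + h - v, v + g - h, v - g + h, g + h - v)"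

lemma tri_set_eq_image: "tri_set u = det_to_tri ` det_set u"
proof (rule set_eqI, rule iffI)
  fix z assume "z \<in> tri_set u"
  then obtain a b c w where z: "z = (a, b, c, w)" and pos: "0 < a" "0 < b" "0 < c"
    and par: "odd a" "odd w" "4 dvd (a - b)" "4 dvd (b - c)"
    and eq: "a * b + b * c + c * a + w\<^sup>2 = 4 * u" by (auto simp: tri_set_def)
  from par obtain i where i: "a = b + 4 * i" by (metis add.commute diff_eq_eq dvdE)
  from par obtain j where j: "b = c + 4 * j" by (metis add.commute diff_eq_eq dvdE)
  have "odd b" using par i by simp
  then have "even (b + w)" using par by simp
  then obtain g where g: "b + w = 2 * g" by (rule evenE)
  have b: "b = 2 * g - w" using g by simp
  \<comment> \<open>These are \<open>(a - w) / 2\<close>, \<open>(b + c) / 2\<close> and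
    \<open>(c + w) / 2\<close>, written through \<open>i\<close> and \<open>j\<close> so that the
    congruences modulo 4 turn into parities.\<close>
  define q where "q = g + 2 * i - w"
  define v where "v = b - 2 * j"
  define h where "h = g - 2 * j"
  have c: "c = 2 * g - w - 4 * j" and a: "a = 2 * g - w + 4 * i" using b i j by auto
  have "4 * (q * v + g * h) = 4 * u"
    unfolding eq[symmetric] q_def v_def h_def a b c by (simp add: algebra_simps power2_eq_square)
  then have "q * v + g * h = u" by simp
  moreover have "odd v" using \<open>odd b\<close> v_def by simp
  moreover have "even (g - h)" "odd (g + q)" using par by (simp_all add: h_def q_def)
  ultimately have "(q, v, g, h) \<in> det_set u"
    using pos by (simp add: det_set_def a b c q_def v_def h_def)
  moreover have "z = det_to_tri (q, v, g, h)"
    by (simp add: z a b c q_def v_def h_def)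
  ultimately show "z \<in> det_to_tri ` det_set u" by (rule rev_image_eqI)
next
  fix z assume "z \<in> det_to_tri ` det_set u"
  then obtain q v g h where z: "z = (2 * q + g + h - v, v + g - h, v - g + h, g + h - v)"
    and "q * v + g * h = u" and par: "odd v" "even (g - h)" "odd (g + q)"
    and "v < g + h + 2 * q" "h - g < v" "g - h < v" by (auto simp: det_set_def)
  moreover have "4 dvd (2 * q + g + h - v - (v + g - h))" "4 dvd (v + g - h - (v - g + h))"
    using par by presburger+
  ultimately show "z \<in> tri_set u"
    by (simp add: tri_set_def algebra_simps power2_eq_square)
qed

lemma inj_det_to_tri: "inj_on det_to_tri A"
  by (rule inj_onI) auto

lemma finite_det_set: "finite (det_set u)"
  using finite_tri_set[of u] unfolding tri_set_eq_image
  by (rule finite_imageD) (rule inj_det_to_tri)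

lemma sum_tri_eq_sum_det:
  "(\<Sum>(a, b, c, w)\<in>tri_set u. (a - w) * (b + w)) = 4 * (\<Sum>(q, v, g, h)\<in>det_set u. q * g)"
  unfolding tri_set_eq_image sum_distrib_left
  by (subst sum.reindex[OF inj_det_to_tri], rule sum.cong) (auto simp: algebra_simps)

text \<open>
  The shift \<open>(v, h) \<mapsto> (v - 2 * g, h + 2 * q)\<close> fixes \<open>q\<close>, \<open>g\<close> and \<open>u\<close>. On each of its orbits \<open>up_set\<close> is an
  interval. One end of these intervals consists of the reduced points with \<open>0 < q < g\<close>, the other is
  the image of the reduced points with \<open>q < 0 < g\<close>. The set \<open>down_set\<close> plays the same role for \<open>0 < g < q\<close>.
\<close>

definition up_set :: "int \<Rightarrow> int4 set" where
  "up_set u = {(q, v, g, h). q * v + g * h = u \<and> odd v \<and> even (g - h) \<and> odd (g + q) \<and>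
     0 < q \<and> q < g \<and> v - h < g + 2 * q \<and> g < v + h}"

definition down_set :: "int \<Rightarrow> int4 set" where
  "down_set u = {(q, v, g, h). q * v + g * h = u \<and> odd v \<and> even (g - h) \<and> odd (g + q) \<and>
     0 < g \<and> g < q \<and> 2 * q - g < v + h \<and> h - v < g}"

text \<open>With \<open>a = v - h\<close> and \<open>b = v + h\<close> the equation reads
  \<open>b * (g + q) = 2 * u + a * (g - q)\<close>. Inserting the lower bound for \<open>b\<close>
  and the upper bound for \<open>a\<close>, the leading terms \<open>g * g + g * q\<close> cancel
  and \<open>g + q < 2 * u\<close> remains; then \<open>a\<close> and \<open>b\<close> are bounded
  too.\<close>

lemma finite_up_set: "finite (up_set u)"
proof (rule finite_subset)
  let ?B = "2 * u + 8 * u * u + 6 * u"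
  show "up_set u \<subseteq> {0..2*u} \<times> {- ?B..?B} \<times> {0..2*u} \<times> {- ?B..?B}"
  proof
    fix z assume "z \<in> up_set u"
    then obtain q v g h where z: "z = (q, v, g, h)" and eq: "q * v + g * h = u"
      and q: "0 < q" "q < g" and lt: "v - h < g + 2 * q" "g < v + h"
      by (auto simp: up_set_def)
    define a b where "a = v - h" and "b = v + h"
    have ab: "b * (g + q) = 2 * u + a * (g - q)"
      using eq by (simp add: a_def b_def algebra_simps)
    have "(g + 1) * (g + q) \<le> b * (g + q)" using q lt b_def by (intro mult_right_mono) auto
    moreover have "a * (g - q) \<le> (g + 2 * q) * (g - q)" using q lt a_def by (intro mult_right_mono) auto
    moreover have "(g + 2 * q) * (g - q) = g * g + g * q - 2 * (q * q)" by (simp add: algebra_simps)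
    moreover have "(g + 1) * (g + q) = g * g + g * q + g + q" by (simp add: algebra_simps)
    moreover have "0 < q * q" using q by simp
    ultimately have gq: "g + q < 2 * u" using ab by linarith
    have bpos: "0 < b * (g + q)" using q lt b_def by simp
    then have "0 < 2 * u + a * (g - q)" using ab by simp
    have a1: "- (2 * u) < a"
    proof (rule ccontr)
      assume "\<not> - (2 * u) < a"
      then have "a \<le> - (2 * u)" "a \<le> 0" using gq q by auto
      then have "a * (g - q) \<le> a * 1" using q by (intro mult_left_mono_neg) auto
      then show False using \<open>0 < 2 * u + a * (g - q)\<close> \<open>a \<le> - (2 * u)\<close> by simp
    qed
    have a2: "a < 6 * u" using lt gq q a_def by simp
    have "a * (g - q) \<le> (g + 2 * q) * (g - q)" by fact
    also have "\<dots> \<le> (4 * u) * (2 * u)" using gq q by (intro mult_mono) auto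
    finally have "b * (g + q) \<le> 2 * u + 8 * u * u" using ab by simp
    moreover have "b * 1 \<le> b * (g + q)" using q lt b_def by (intro mult_left_mono) auto
    ultimately have b: "b \<le> 2 * u + 8 * u * u" by simp
    have "0 < b" using lt q b_def by simp
    have "v \<le> ?B" "h \<le> ?B" "- ?B \<le> v" "- ?B \<le> h"
      using a1 a2 b \<open>0 < b\<close> gq q unfolding a_def b_def by linarith+
    then show "z \<in> {0..2*u} \<times> {- ?B..?B} \<times> {0..2*u} \<times> {- ?B..?B}"
      using gq q by (simp add: z)
  qed
qed auto

text \<open>As for \<open>up_set\<close>, but \<open>q - g\<close> is now the positive factor, so
  lower bounds for both \<open>a\<close> and \<open>b\<close> give
  \<open>g + q < 2 * u\<close>.\<close>

lemma finite_down_set: "finite (down_set u)"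
proof (rule finite_subset)
  let ?B = "6 * u + 4 * u * u"
  show "down_set u \<subseteq> {0..2*u} \<times> {- ?B..?B} \<times> {0..2*u} \<times> {- ?B..?B}"
  proof
    fix z assume "z \<in> down_set u"
    then obtain q v g h where z: "z = (q, v, g, h)" and eq: "q * v + g * h = u"
      and q: "0 < g" "g < q" and lt: "2 * q - g < v + h" "h - v < g"
      by (auto simp: down_set_def)
    define a b where "a = v - h" and "b = v + h"
    have ab: "b * (g + q) + a * (q - g) = 2 * u"
      using eq by (simp add: a_def b_def algebra_simps)
    have "(2 * q - g + 1) * (g + q) \<le> b * (g + q)" using q lt b_def by (intro mult_right_mono) auto
    then have 1: "2 * (q * q) + g * q - g * g + g + q \<le> b * (g + q)" by (simp add: algebra_simps)
    have "(- g) * (q - g) \<le> a * (q - g)" using q lt a_def by (intro mult_right_mono) auto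
    then have 2: "- (g * (q - g)) \<le> a * (q - g)" by simp
    have 3: "g * (q - g) = g * q - g * g" by (simp add: algebra_simps)
    have 4: "0 < q * q" using q by simp
    have gq: "g + q < 2 * u" using ab 1 2 3 4 by linarith
    have b0: "0 < b" using q lt b_def by simp
    then have "0 < b * (g + q)" using q by simp
    have a1: "a < 2 * u"
    proof (rule ccontr)
      assume "\<not> a < 2 * u"
      then have "a * 1 \<le> a * (q - g)" using q gq by (intro mult_left_mono) auto
      then show False using ab \<open>0 < b * (g + q)\<close> \<open>\<not> a < 2 * u\<close> by simp
    qed
    have a2: "- (2 * u) < a" using lt gq q a_def by simp
    have 5: "g * (q - g) \<le> (2 * u) * (2 * u)" using gq q by (intro mult_mono) auto
    have "b * (g + q) \<le> 2 * u + 4 * u * u" using ab 2 5 by linarith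
    moreover have "b * 1 \<le> b * (g + q)" using q b0 by (intro mult_left_mono) auto
    ultimately have b: "b \<le> 2 * u + 4 * u * u" by simp
    have "v \<le> ?B" "h \<le> ?B" "- ?B \<le> v" "- ?B \<le> h"
      using a1 a2 b b0 gq q unfolding a_def b_def by linarith+
    then show "z \<in> {0..2*u} \<times> {- ?B..?B} \<times> {0..2*u} \<times> {- ?B..?B}"
      using gq q by (simp add: z)
  qed
qed auto

text \<open>The map \<open>s\<close> is a bijection from the points that it keeps in
  \<open>Z\<close> to the points that \<open>t\<close> keeps in \<open>Z\<close>. Subtracting these
  equal sums from the total leaves the two ends of the orbits.\<close>

lemma sum_first_eq_sum_last:
  fixes F :: "'a \<Rightarrow> int"
  assumes "finite Z" and inv: "\<And>z. s (t z) = z" "\<And>z. t (s z) = z" and F: "\<And>z. F (s z) = F z"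
  shows "(\<Sum>z | z \<in> Z \<and> s z \<notin> Z. F z) = (\<Sum>z | z \<in> Z \<and> t z \<notin> Z. F z)"
proof -
  have "(\<Sum>z | z \<in> Z \<and> s z \<in> Z. F z) = (\<Sum>z | z \<in> Z \<and> t z \<in> Z. F z)"
    by (rule sum.reindex_bij_witness[of _ t s]) (auto simp: inv F)
  moreover have split: "(\<Sum>z\<in>Z. F z) = (\<Sum>z | z \<in> Z \<and> f z \<in> Z. F z) + (\<Sum>z | z \<in> Z \<and> f z \<notin> Z. F z)"
    for f :: "'a \<Rightarrow> 'a"
    by (subst sum.union_disjoint[symmetric]) (auto intro!: sum.cong simp: \<open>finite Z\<close>)
  ultimately show ?thesis using split[of s] split[of t] by linarith
qed

text \<open>
  On \<open>det_set\<close> outside \<open>red_set\<close> the map \<open>(g, h) \<mapsto> (- g, - h)\<close> is an involution that negates \<open>q * g\<close>.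
\<close>

definition red_set :: "int \<Rightarrow> int4 set" where
  "red_set u = {(q, v, g, h). (q, v, g, h) \<in> det_set u \<and> 2 * q - v < g + h}"

lemmas set_defs = red_set_def det_set_def up_set_def down_set_def

lemma sum_up:
  "(\<Sum>(q, v, g, h) | (q, v, g, h) \<in> red_set u \<and> 0 < q \<and> q < g. q * g) =
   - (\<Sum>(q, v, g, h) | (q, v, g, h) \<in> red_set u \<and> q < 0 \<and> 0 < g. q * g)"
proof -
  let ?s = "\<lambda>(q, v, g, h). (q, v - 2 * g, g, h + 2 * q) :: int4"
  let ?t = "\<lambda>(q, v, g, h). (q, v + 2 * g, g, h - 2 * q) :: int4"
  \<comment> \<open>The shift \<open>?s\<close> followed by the sign change
    \<open>(q, v) \<mapsto> (- q, - v)\<close>. The composite is an involution and negates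
    \<open>q * g\<close>.\<close>
  let ?j = "\<lambda>(q, v, g, h). (- q, 2 * g - v, g, h + 2 * q) :: int4"
  let ?F = "\<lambda>(q, v, g, h). q * g :: int"
  \<comment> \<open>Leaving \<open>up_set\<close> under \<open>?t\<close> gives only
    \<open>h - g \<le> v\<close>; equality is excluded because \<open>v\<close> is odd and
    \<open>g - h\<close> is even. Parity closes the boundary cases in the same way below.\<close>
  have "{(q, v, g, h). (q, v, g, h) \<in> red_set u \<and> 0 < q \<and> q < g} = {z. z \<in> up_set u \<and> ?t z \<notin> up_set u}"
    by (auto simp: set_defs algebra_simps) (metis even_add linorder_neqE_linordered_idom)+
  moreover have "(\<Sum>z | z \<in> up_set u \<and> ?s z \<notin> up_set u. ?F z) = (\<Sum>z | z \<in> up_set u \<and> ?t z \<notin> up_set u. ?F z)"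
    by (rule sum_first_eq_sum_last) (auto simp: finite_up_set)
  moreover have "(\<Sum>z | z \<in> up_set u \<and> ?s z \<notin> up_set u. ?F z) =
    (\<Sum>z\<in>{(q, v, g, h). (q, v, g, h) \<in> red_set u \<and> q < 0 \<and> 0 < g}. - ?F z)"
    apply (rule sum.reindex_bij_witness[of _ ?j ?j])
     apply (auto simp: set_defs algebra_simps)
     apply (metis even_add even_mult_iff even_numeral odd_numeral linorder_neqE_linordered_idom)+
    done
  ultimately show ?thesis by (simp add: sum_negf)
qed

lemma sum_down:
  "(\<Sum>(q, v, g, h) | (q, v, g, h) \<in> red_set u \<and> 0 < g \<and> g < q. q * g) =
   - (\<Sum>(q, v, g, h) | (q, v, g, h) \<in> red_set u \<and> g < 0 \<and> 0 < q. q * g)"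
proof -
  let ?s = "\<lambda>(q, v, g, h). (q, v + 2 * g, g, h - 2 * q) :: int4"
  let ?t = "\<lambda>(q, v, g, h). (q, v - 2 * g, g, h + 2 * q) :: int4"
  \<comment> \<open>The shift \<open>?s\<close>, now in the opposite direction, followed by the sign
    change of \<open>(g, h)\<close>; again an involution.\<close>
  let ?k = "\<lambda>(q, v, g, h). (q, v + 2 * g, - g, 2 * q - h) :: int4"
  let ?F = "\<lambda>(q, v, g, h). q * g :: int"
  have "{(q, v, g, h). (q, v, g, h) \<in> red_set u \<and> 0 < g \<and> g < q} = {z. z \<in> down_set u \<and> ?t z \<notin> down_set u}"
    by (auto simp: set_defs algebra_simps) (metis even_add even_mult_iff dvd_refl linorder_neqE_linordered_idom)+
  moreover have "(\<Sum>z | z \<in> down_set u \<and> ?s z \<notin> down_set u. ?F z) = (\<Sum>z | z \<in> down_set u \<and> ?t z \<notin> down_set u. ?F z)"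
    by (rule sum_first_eq_sum_last) (auto simp: finite_down_set)
  moreover have "(\<Sum>z | z \<in> down_set u \<and> ?s z \<notin> down_set u. ?F z) =
    (\<Sum>z\<in>{(q, v, g, h). (q, v, g, h) \<in> red_set u \<and> g < 0 \<and> 0 < q}. - ?F z)"
    apply (rule sum.reindex_bij_witness[of _ ?k ?k])
     apply (auto simp: set_defs algebra_simps)
     apply (metis even_add even_mult_iff even_numeral odd_numeral linorder_neqE_linordered_idom)+
    done
  ultimately show ?thesis by (simp add: sum_negf)
qed

lemma sum_det_unreduced: "(\<Sum>(q, v, g, h)\<in>det_set u - red_set u. q * g) = 0"
proof -
  let ?F = "\<lambda>(q, v, g, h). q * g :: int"
  let ?i = "\<lambda>(q, v, g, h). (q, v, - g, - h) :: int4"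
  have "(\<Sum>z\<in>det_set u - red_set u. ?F z) = (\<Sum>z\<in>det_set u - red_set u. - ?F z)"
    apply (rule sum.reindex_bij_witness[of _ ?i ?i])
    apply (auto simp: set_defs algebra_simps)
     apply (metis even_add even_mult_iff even_numeral odd_numeral linorder_neqE_linordered_idom)+
    done
  then show ?thesis by (simp add: sum_negf)
qed

lemma red_set_subset: "red_set u \<subseteq> det_set u"
  by (auto simp: red_set_def)

lemma finite_red_set: "finite (red_set u)"
  using finite_det_set red_set_subset by (rule finite_subset[rotated])

text \<open>Split the terms with \<open>q * g \<noteq> 0\<close> by signs. Parity excludes
  \<open>q = g\<close>, and \<open>q, g < 0\<close> would make \<open>q * v\<close> and
  \<open>g * h\<close> negative, as \<open>0 < v\<close> and \<open>0 < g + h\<close>. Of the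
  remaining four regions, \<open>A1\<close> cancels \<open>A2\<close> and \<open>A3\<close> cancels
  \<open>A4\<close>.\<close>

lemma sum_red:
  assumes "0 < u"
  shows "(\<Sum>(q, v, g, h)\<in>red_set u. q * g) = 0"
proof -
  let ?F = "\<lambda>(q, v, g, h). q * g :: int"
  define A1 A2 A3 A4 where
    "A1 = {(q, v, g, h). (q, v, g, h) \<in> red_set u \<and> 0 < q \<and> q < g}" and
    "A2 = {(q, v, g, h). (q, v, g, h) \<in> red_set u \<and> q < 0 \<and> 0 < g}" and
    "A3 = {(q, v, g, h). (q, v, g, h) \<in> red_set u \<and> 0 < g \<and> g < q}" and
    "A4 = {(q, v, g, h). (q, v, g, h) \<in> red_set u \<and> g < 0 \<and> 0 < q}"
  note A = A1_def A2_def A3_def A4_def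
  have fin: "finite A1" "finite A2" "finite A3" "finite A4"
    by (rule finite_subset[OF _ finite_red_set[of u]]; auto simp: A)+
  have "(\<Sum>z\<in>red_set u. ?F z) = (\<Sum>z\<in>A1 \<union> A2 \<union> (A3 \<union> A4). ?F z)"
  proof (rule sum.mono_neutral_right[OF finite_red_set])
    show "A1 \<union> A2 \<union> (A3 \<union> A4) \<subseteq> red_set u" by (auto simp: A)
    show "\<forall>z\<in>red_set u - (A1 \<union> A2 \<union> (A3 \<union> A4)). ?F z = 0"
    proof
      fix z assume "z \<in> red_set u - (A1 \<union> A2 \<union> (A3 \<union> A4))"
      then obtain q v g h where z: "z = (q, v, g, h)" and red: "(q, v, g, h) \<in> red_set u"
        and out: "(q, v, g, h) \<notin> A1" "(q, v, g, h) \<notin> A2" "(q, v, g, h) \<notin> A3" "(q, v, g, h) \<notin> A4"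
        by (cases z) auto
      have eq: "q * v + g * h = u" and ineq: "0 < g + h" "0 < v" and par: "odd (g + q)"
        using red by (auto simp: set_defs)
      have "q = 0 \<or> g = 0"
      proof (rule ccontr)
        assume "\<not> (q = 0 \<or> g = 0)"
        moreover have "q \<noteq> g" using par by auto
        ultimately have neg: "q < 0" "g < 0" using out red unfolding A by auto
        then have "q * v < 0" "g * h < 0" using ineq by (simp_all add: mult_neg_pos)
        then show False using eq assms by linarith
      qed
      then show "?F z = 0" by (auto simp: z)
    qed
  qed
  also have "\<dots> = (\<Sum>z\<in>A1. ?F z) + (\<Sum>z\<in>A2. ?F z) + ((\<Sum>z\<in>A3. ?F z) + (\<Sum>z\<in>A4. ?F z))"
    using fin by (subst sum.union_disjoint; (subst sum.union_disjoint)?; (subst sum.union_disjoint)?; (auto simp: A)?)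
  also have "\<dots> = 0"
    using sum_up[of u] sum_down[of u] by (simp add: A)
  finally show ?thesis .
qed

lemma sum_det:
  assumes "0 < u"
  shows "(\<Sum>(q, v, g, h)\<in>det_set u. q * g) = 0"
  using sum.subset_diff[OF red_set_subset finite_det_set, of "\<lambda>(q, v, g, h). q * g" u]
    sum_det_unreduced[of u] sum_red[OF assms] by simp

text \<open>Since \<open>(a - w) * (b + w) = (a * b - w\<^sup>2) + w * (a - b)\<close> and the last
  term cancels under swapping \<open>a\<close> and \<open>b\<close>, the sum of
  \<open>a * b - w\<^sup>2\<close> vanishes. Its three cyclic versions add up to
  \<open>4 * u - 4 * w\<^sup>2\<close>.\<close>

lemma sum_tri:
  assumes "0 < u"
  shows "(\<Sum>(a, b, c, w)\<in>tri_set u. u - w\<^sup>2) = 0"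
proof -
  let ?T = "tri_set u"
  let ?sw = "\<lambda>(a, b, c, w). (b, a, c, w) :: int4"
  let ?rot = "\<lambda>(a, b, c, w). (b, c, a, w) :: int4" and ?rot' = "\<lambda>(a, b, c, w). (c, a, b, w) :: int4"
  have sw: "?sw z \<in> ?T" if "z \<in> ?T" for z
    using that by (auto simp: tri_set_def algebra_simps; presburger)
  have rot: "?rot z \<in> ?T" if "z \<in> ?T" for z
    using that by (auto simp: tri_set_def algebra_simps; presburger)
  have rot': "?rot' z \<in> ?T" if "z \<in> ?T" for z
    using that by (auto simp: tri_set_def algebra_simps; presburger)
  have "(\<Sum>(a, b, c, w)\<in>?T. w * (a - b)) = (\<Sum>(a, b, c, w)\<in>?T. w * (b - a))"
    by (rule sum.reindex_bij_witness[of _ ?sw ?sw]) (auto dest: sw)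
  also have "\<dots> = - (\<Sum>(a, b, c, w)\<in>?T. w * (a - b))"
    by (simp add: sum_negf[symmetric] case_prod_beta algebra_simps)
  finally have anti: "(\<Sum>(a, b, c, w)\<in>?T. w * (a - b)) = 0" by simp
  have ab: "(\<Sum>(a, b, c, w)\<in>?T. a * b - w\<^sup>2) = 0"
  proof -
    have "(\<Sum>(a, b, c, w)\<in>?T. a * b - w\<^sup>2) =
        (\<Sum>(a, b, c, w)\<in>?T. (a - w) * (b + w)) - (\<Sum>(a, b, c, w)\<in>?T. w * (a - b))"
      by (simp add: sum_subtractf[symmetric] case_prod_beta algebra_simps power2_eq_square)
    then show ?thesis using anti sum_tri_eq_sum_det[of u] sum_det[OF assms] by simp
  qed
  have bc: "(\<Sum>(a, b, c, w)\<in>?T. b * c - w\<^sup>2) = (\<Sum>(a, b, c, w)\<in>?T. a * b - w\<^sup>2)"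
    by (rule sum.reindex_bij_witness[of _ ?rot' ?rot]) (auto dest: rot rot')
  have ca: "(\<Sum>(a, b, c, w)\<in>?T. c * a - w\<^sup>2) = (\<Sum>(a, b, c, w)\<in>?T. b * c - w\<^sup>2)"
    by (rule sum.reindex_bij_witness[of _ ?rot' ?rot]) (auto dest: rot rot')
  have "4 * (\<Sum>(a, b, c, w)\<in>?T. u - w\<^sup>2) = (\<Sum>(a, b, c, w)\<in>?T. 4 * u - 4 * w\<^sup>2)"
    by (simp add: sum_distrib_left case_prod_beta algebra_simps)
  also have "\<dots> = (\<Sum>(a, b, c, w)\<in>?T. (a * b - w\<^sup>2) + (b * c - w\<^sup>2) + (c * a - w\<^sup>2))"
    by (rule sum.cong) (auto simp: tri_set_def)
  also have "\<dots> = (\<Sum>(a, b, c, w)\<in>?T. a * b - w\<^sup>2) + (\<Sum>(a, b, c, w)\<in>?T. b * c - w\<^sup>2)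
      + (\<Sum>(a, b, c, w)\<in>?T. c * a - w\<^sup>2)"
    by (simp add: sum.distrib[symmetric] case_prod_beta)
  also have "\<dots> = 0" using ab bc ca by simp
  finally show ?thesis by simp
qed

definition sq_set :: "int \<Rightarrow> int4 set" where
  "sq_set u = {(a, b, c, w). odd a \<and> odd b \<and> odd c \<and> odd w \<and> a\<^sup>2 + b\<^sup>2 + c\<^sup>2 + w\<^sup>2 = 4 * u}"

lemma sum_sq: "(\<Sum>(a, b, c, w)\<in>sq_set u. u - w\<^sup>2) = 0"
proof -
  let ?T = "sq_set u"
  let ?rot = "\<lambda>(a, b, c, w). (b, c, w, a) :: int4" and ?rot' = "\<lambda>(a, b, c, w). (w, a, b, c) :: int4"
  have 1: "(\<Sum>(a, b, c, w)\<in>?T. u - w\<^sup>2) = (\<Sum>(a, b, c, w)\<in>?T. u - c\<^sup>2)"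
    and 2: "(\<Sum>(a, b, c, w)\<in>?T. u - c\<^sup>2) = (\<Sum>(a, b, c, w)\<in>?T. u - b\<^sup>2)"
    and 3: "(\<Sum>(a, b, c, w)\<in>?T. u - b\<^sup>2) = (\<Sum>(a, b, c, w)\<in>?T. u - a\<^sup>2)"
    by (rule sum.reindex_bij_witness[of _ ?rot' ?rot]; auto simp: sq_set_def algebra_simps)+
  have "4 * (\<Sum>(a, b, c, w)\<in>?T. u - w\<^sup>2) = (\<Sum>(a, b, c, w)\<in>?T. u - a\<^sup>2) + (\<Sum>(a, b, c, w)\<in>?T. u - b\<^sup>2)
      + (\<Sum>(a, b, c, w)\<in>?T. u - c\<^sup>2) + (\<Sum>(a, b, c, w)\<in>?T. u - w\<^sup>2)"
    using 1 2 3 by simp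
  also have "\<dots> = (\<Sum>(a, b, c, w)\<in>?T. (u - a\<^sup>2) + (u - b\<^sup>2) + (u - c\<^sup>2) + (u - w\<^sup>2))"
    by (simp add: sum.distrib[symmetric] case_prod_beta)
  also have "\<dots> = 0"
    by (rule sum.neutral) (auto simp: sq_set_def)
  finally show ?thesis by simp
qed

section \<open>Counting functions and their common recursion\<close>

definition tri_triples :: "int \<Rightarrow> (int \<times> int \<times> int) set" where
  "tri_triples M = {(a, b, c). 0 < a \<and> 0 < b \<and> 0 < c \<and> odd a \<and> 4 dvd (a - b) \<and> 4 dvd (b - c) \<and>
     a * b + b * c + c * a = M}"

definition sq_triples :: "int \<Rightarrow> (int \<times> int \<times> int) set" where
  "sq_triples M = {(a, b, c). odd a \<and> odd b \<and> odd c \<and> a\<^sup>2 + b\<^sup>2 + c\<^sup>2 = M}"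

lemma tri_triples_empty:
  assumes "M \<le> 0"
  shows "tri_triples M = {}"
proof -
  have "a * b + b * c + c * a \<noteq> M" if "0 < a" "0 < b" "0 < c" for a b c :: int
  proof -
    have "0 < a * b" "0 < b * c" "0 < c * a" using that by simp_all
    then show ?thesis using assms by linarith
  qed
  then show ?thesis by (simp add: tri_triples_def)
qed

lemma sq_triples_empty:
  assumes "M \<le> 0"
  shows "sq_triples M = {}"
proof -
  have "a\<^sup>2 + b\<^sup>2 + c\<^sup>2 \<noteq> M" if "odd a" for a b c :: int
  proof -
    have "0 < a\<^sup>2" "0 \<le> b\<^sup>2" "0 \<le> c\<^sup>2" using that by auto
    then show ?thesis using assms by linarith
  qed
  then show ?thesis by (auto simp: sq_triples_def)
qed

lemma finite_sq_triples: "finite (sq_triples M)"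
proof (rule finite_subset)
  show "sq_triples M \<subseteq> {-M..M} \<times> {-M..M} \<times> {-M..M}"
  proof
    fix z assume "z \<in> sq_triples M"
    then obtain a b c where z: "z = (a, b, c)" and eq: "a\<^sup>2 + b\<^sup>2 + c\<^sup>2 = M" by (auto simp: sq_triples_def)
    have "0 \<le> a\<^sup>2" "0 \<le> b\<^sup>2" "0 \<le> c\<^sup>2" by simp_all
    then have "\<bar>a\<bar> \<le> M" "\<bar>b\<bar> \<le> M" "\<bar>c\<bar> \<le> M"
      using abs_le_square_int[of a] abs_le_square_int[of b] abs_le_square_int[of c] eq by linarith+
    then show "z \<in> {-M..M} \<times> {-M..M} \<times> {-M..M}" by (auto simp: z)
  qed
qed auto

lemma finite_tri_triples: "finite (tri_triples M)"
proof (rule finite_subset)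
  show "tri_triples M \<subseteq> {0..M} \<times> {0..M} \<times> {0..M}"
  proof
    fix z assume "z \<in> tri_triples M"
    then obtain a b c where z: "z = (a, b, c)" and pos: "0 < a" "0 < b" "0 < c"
      and eq: "a * b + b * c + c * a = M" by (auto simp: tri_triples_def)
    have 1: "a * 1 \<le> a * b" "b * 1 \<le> b * c" "c * 1 \<le> c * a"
      using pos by (intro mult_left_mono; simp)+
    have "a \<le> M" "b \<le> M" "c \<le> M" using 1 eq pos by linarith+
    then show "z \<in> {0..M} \<times> {0..M} \<times> {0..M}" using pos by (auto simp: z)
  qed
qed auto

lemma sum_by_last:
  fixes F :: "'d \<Rightarrow> int"
  assumes "finite W" "\<And>w. w \<in> W \<Longrightarrow> finite (T w)"
  shows "(\<Sum>(a, b, c, w) | w \<in> W \<and> (a, b, c) \<in> T w. F w) = (\<Sum>w\<in>W. F w * int (card (T w)))"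
proof -
  have "(\<Sum>w\<in>W. F w * int (card (T w))) = (\<Sum>w\<in>W. \<Sum>x\<in>T w. F w)"
    by (simp add: mult.commute)
  also have "\<dots> = (\<Sum>(w, x)\<in>Sigma W T. F w)"
    by (rule sum.Sigma) (use assms in auto)
  also have "\<dots> = (\<Sum>(a, b, c, w) | w \<in> W \<and> (a, b, c) \<in> T w. F w)"
    by (rule sum.reindex_bij_witness[of _ "\<lambda>(a, b, c, w). (w, a, b, c)" "\<lambda>(w, a, b, c). (a, b, c, w)"]) auto
  finally show ?thesis by simp
qed

text \<open>A finite window that contains every \<open>w\<close> with
  \<open>w\<^sup>2 \<le> 4 * u\<close>; for larger \<open>w\<close> both counts are taken at a
  negative argument and vanish.\<close>

definition odds :: "int \<Rightarrow> int set" where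
  "odds u = {w. odd w \<and> w \<in> {- (4 * u)..4 * u}}"

lemma finite_odds: "finite (odds u)"
  by (rule finite_subset[of _ "{- (4 * u)..4 * u}"]) (auto simp: odds_def)

lemma tri_recursion:
  assumes "0 < u"
  shows "(\<Sum>w\<in>odds u. (u - w\<^sup>2) * int (card (tri_triples (4 * u - w\<^sup>2)))) = 0"
proof -
  have "tri_set u = {(a, b, c, w). w \<in> odds u \<and> (a, b, c) \<in> tri_triples (4 * u - w\<^sup>2)}"
  proof (rule set_eqI)
    fix z :: int4
    obtain a b c w where z: "z = (a, b, c, w)" by (cases z)
    have "w \<in> {- (4 * u)..4 * u}" if "0 < a" "0 < b" "0 < c" "a * b + b * c + c * a + w\<^sup>2 = 4 * u"
    proof -
      have "0 < a * b + b * c + c * a" using that by (simp add: add_pos_pos)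
      then have "\<bar>w\<bar> \<le> 4 * u" using that abs_le_square_int[of w] by linarith
      then show ?thesis by auto
    qed
    then show "z \<in> tri_set u \<longleftrightarrow> z \<in> {(a, b, c, w). w \<in> odds u \<and> (a, b, c) \<in> tri_triples (4 * u - w\<^sup>2)}"
      by (auto simp: z tri_set_def odds_def tri_triples_def)
  qed
  then show ?thesis
    using sum_tri[OF assms] sum_by_last[OF finite_odds finite_tri_triples, where F = "\<lambda>w. u - w\<^sup>2"]
    by simp
qed

lemma sq_recursion:
  "(\<Sum>w\<in>odds u. (u - w\<^sup>2) * int (card (sq_triples (4 * u - w\<^sup>2)))) = 0"
proof -
  have "sq_set u = {(a, b, c, w). w \<in> odds u \<and> (a, b, c) \<in> sq_triples (4 * u - w\<^sup>2)}"
  proof (rule set_eqI)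
    fix z :: int4
    obtain a b c w where z: "z = (a, b, c, w)" by (cases z)
    have "w \<in> {- (4 * u)..4 * u}" if "a\<^sup>2 + b\<^sup>2 + c\<^sup>2 + w\<^sup>2 = 4 * u"
    proof -
      have "0 \<le> a\<^sup>2" "0 \<le> b\<^sup>2" "0 \<le> c\<^sup>2" by simp_all
      then have "\<bar>w\<bar> \<le> 4 * u" using that abs_le_square_int[of w] by linarith
      then show ?thesis by auto
    qed
    then show "z \<in> sq_set u \<longleftrightarrow> z \<in> {(a, b, c, w). w \<in> odds u \<and> (a, b, c) \<in> sq_triples (4 * u - w\<^sup>2)}"
      by (auto simp: z sq_set_def odds_def sq_triples_def)
  qed
  then show ?thesis
    using sum_sq[of u] sum_by_last[OF finite_odds finite_sq_triples, where F = "\<lambda>w. u - w\<^sup>2"]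
    by simp
qed

lemma odd_square_eq:
  fixes w :: int
  assumes "odd w"
  obtains j where "0 \<le> j" "w\<^sup>2 = 8 * j + 1"
proof -
  obtain k where k: "w = 2 * k + 1" using assms by (rule oddE)
  have "even (k * (k + 1))" by simp
  then obtain j where j: "k * (k + 1) = 2 * j" by (rule evenE)
  have "w\<^sup>2 = 4 * (k * (k + 1)) + 1" by (simp add: k power2_eq_square algebra_simps)
  then have "w\<^sup>2 = 8 * j + 1" using j by simp
  moreover have "0 \<le> j" using \<open>w\<^sup>2 = 8 * j + 1\<close> zero_le_power2[of w] by linarith
  ultimately show ?thesis using that by blast
qed

text \<open>Take \<open>u = 2 * n + 1\<close>. The terms \<open>w = 1\<close> and
  \<open>w = -1\<close> contribute \<open>2 * (u - 1) * d (8 * n + 3)\<close>, and all others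
  evaluate \<open>d\<close> at smaller numbers of the form \<open>8 * n' + 3\<close> or at negative
  ones. The factor \<open>u - 1\<close> vanishes for \<open>n = 0\<close>, hence the separate base
  case.\<close>

lemma recursion_imp_zero:
  fixes d :: "int \<Rightarrow> int"
  assumes neg: "\<And>M. M \<le> 0 \<Longrightarrow> d M = 0"
    and rec: "\<And>u. 0 < u \<Longrightarrow> (\<Sum>w\<in>odds u. (u - w\<^sup>2) * d (4 * u - w\<^sup>2)) = 0"
    and base: "d 3 = 0"
  shows "d (8 * int n + 3) = 0"
proof (induction n rule: less_induct)
  case (less n)
  show ?case
  proof (cases "n = 0")
    case True
    then show ?thesis using base by simp
  next
    case False
    define u where "u = 2 * int n + 1"
    have "(\<Sum>w\<in>odds u. (u - w\<^sup>2) * d (4 * u - w\<^sup>2)) = (\<Sum>w\<in>{1, -1}. (u - w\<^sup>2) * d (4 * u - w\<^sup>2))"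
    proof (rule sum.mono_neutral_right[OF finite_odds])
      show "{1, -1} \<subseteq> odds u" by (auto simp: odds_def u_def)
      show "\<forall>w\<in>odds u - {1, -1}. (u - w\<^sup>2) * d (4 * u - w\<^sup>2) = 0"
      proof
        fix w assume w: "w \<in> odds u - {1, -1}"
        then have "odd w" by (simp add: odds_def)
        then obtain j where j: "0 \<le> j" "w\<^sup>2 = 8 * j + 1" by (rule odd_square_eq)
        have "j \<noteq> 0" using w j by (auto simp: power2_eq_1_iff)
        have eq: "4 * u - w\<^sup>2 = 8 * (int n - j) + 3" using j u_def by simp
        have "d (4 * u - w\<^sup>2) = 0"
        proof (cases "j \<le> int n")
          case True
          then have "nat (int n - j) < n" "int (nat (int n - j)) = int n - j"
            using j \<open>j \<noteq> 0\<close> by linarith+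
          then show ?thesis using less.IH[of "nat (int n - j)"] eq by simp
        next
          case False
          then show ?thesis using eq neg by simp
        qed
        then show "(u - w\<^sup>2) * d (4 * u - w\<^sup>2) = 0" by simp
      qed
    qed
    then have "2 * ((u - 1) * d (4 * u - 1)) = 0" using rec[of u] by (simp add: u_def)
    then show ?thesis using False by (simp add: u_def add.commute)
  qed
qed

theorem three_odd_squares:
  obtains x y z :: int where "odd x" "odd y" "odd z" "x\<^sup>2 + y\<^sup>2 + z\<^sup>2 = 8 * int n + 3"
proof -
  define t s where "t M = int (card (tri_triples M))" and "s M = int (card (sq_triples M))" for M
  \<comment> \<open>The combination of two solutions of the recursion that vanishes at 3. It
    therefore vanishes at \<open>8 * n + 3\<close>, where \<open>s 3 > 0\<close> and
    \<open>t > 0\<close> force \<open>s \<noteq> 0\<close>.\<close>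
  define d where "d M = t 3 * s M - s 3 * t M" for M
  have "d (8 * int n + 3) = 0"
  proof (rule recursion_imp_zero)
    show "d M = 0" if "M \<le> 0" for M
      using that by (simp add: d_def t_def s_def tri_triples_empty sq_triples_empty)
    show "(\<Sum>w\<in>odds u. (u - w\<^sup>2) * d (4 * u - w\<^sup>2)) = 0" if "0 < u" for u
    proof -
      have "(\<Sum>w\<in>odds u. (u - w\<^sup>2) * d (4 * u - w\<^sup>2)) =
          t 3 * (\<Sum>w\<in>odds u. (u - w\<^sup>2) * s (4 * u - w\<^sup>2)) - s 3 * (\<Sum>w\<in>odds u. (u - w\<^sup>2) * t (4 * u - w\<^sup>2))"
        by (simp add: d_def sum_distrib_left sum_subtractf[symmetric] algebra_simps)
      then show ?thesis using tri_recursion[OF that] sq_recursion[of u] by (simp add: t_def s_def)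
    qed
    show "d 3 = 0" by (simp add: d_def)
  qed
  moreover have "0 < s 3"
  proof -
    have "(1, 1, 1) \<in> sq_triples 3" by (simp add: sq_triples_def)
    then show ?thesis using finite_sq_triples[of 3] by (auto simp: s_def card_gt_0_iff)
  qed
  moreover have "0 < t (8 * int n + 3)"
  proof -
    have "(1, 1, 4 * int n + 1) \<in> tri_triples (8 * int n + 3)" by (simp add: tri_triples_def)
    then show ?thesis using finite_tri_triples by (auto simp: t_def card_gt_0_iff)
  qed
  ultimately have "s (8 * int n + 3) \<noteq> 0" by (auto simp: d_def)
  then have "sq_triples (8 * int n + 3) \<noteq> {}" by (auto simp: s_def)
  then obtain w where w: "w \<in> sq_triples (8 * int n + 3)" by blast
  obtain x y z where xyz: "w = (x, y, z)" by (cases w)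
  show ?thesis by (rule that[of x y z]) (use w in \<open>simp_all add: sq_triples_def xyz\<close>)
qed

section \<open>Cauchy's lemma and sums of four squares\<close>

text \<open>The number \<open>4 * a - b\<^sup>2\<close> is 3 modulo 8, hence
  \<open>x\<^sup>2 + y\<^sup>2 + z\<^sup>2\<close> with odd entries. After choosing the sign of
  \<open>z\<close> so that 4 divides \<open>b + x + y + z\<close>, the integers are
  \<open>(b + x + y + z) / 4\<close>, \<open>(b + x - y - z) / 4\<close>,
  \<open>(b - x + y - z) / 4\<close> and \<open>(b - x - y + z) / 4\<close>.\<close>

lemma cauchy_lemma:
  fixes a b :: int
  assumes "odd a" "odd b" "b\<^sup>2 < 4 * a"
  obtains s t u v :: int where "s\<^sup>2 + t\<^sup>2 + u\<^sup>2 + v\<^sup>2 = a" "s + t + u + v = b"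
proof -
  obtain k where k: "a = 2 * k + 1" using assms(1) by (rule oddE)
  obtain j where j: "b\<^sup>2 = 8 * j + 1" using assms(2) by (rule odd_square_eq)
  have eq: "4 * a - b\<^sup>2 = 8 * (k - j) + 3" using k j by simp
  then have "0 < 8 * (k - j) + 3" using assms(3) by linarith
  then have "0 \<le> k - j" by presburger
  then have "4 * a - b\<^sup>2 = 8 * int (nat (k - j)) + 3" using eq by simp
  moreover obtain x y z where xyz: "odd x" "odd y" "odd z" "x\<^sup>2 + y\<^sup>2 + z\<^sup>2 = 8 * int (nat (k - j)) + 3"
    by (rule three_odd_squares)
  ultimately have sum: "x\<^sup>2 + y\<^sup>2 + z\<^sup>2 = 4 * a - b\<^sup>2" by simp
  obtain z' where z': "z' = z \<or> z' = - z" "4 dvd (b + x + y + z')"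
  proof -
    have "4 dvd (b + x + y + z) \<or> 4 dvd (b + x + y + (- z))"
      using xyz(1-3) assms(2) by presburger
    then show ?thesis using that by blast
  qed
  have "odd z'" using z'(1) xyz(3) by auto
  have sq: "x\<^sup>2 + y\<^sup>2 + z'\<^sup>2 = 4 * a - b\<^sup>2" using z'(1) sum by auto
  obtain s where s: "b + x + y + z' = 4 * s" using z'(2) by (rule dvdE)
  have "even (x + y)" "even (x + z')" "even (y + z')" using xyz(1-3) \<open>odd z'\<close> by simp_all
  then obtain p q r where pqr: "x + y = 2 * p" "x + z' = 2 * q" "y + z' = 2 * r"
    unfolding dvd_def by blast
  show ?thesis
  proof (rule that[of s "s - r" "s - q" "s - p"])
    have x: "x = p + q - r" and y: "y = p + r - q" and z: "z' = q + r - p" and b: "b = 4 * s - p - q - r"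
      using pqr s by auto
    have "4 * (s\<^sup>2 + (s - r)\<^sup>2 + (s - q)\<^sup>2 + (s - p)\<^sup>2) = 4 * a"
      using sq unfolding x y z b by (simp add: power2_eq_square algebra_simps)
    then show "s\<^sup>2 + (s - r)\<^sup>2 + (s - q)\<^sup>2 + (s - p)\<^sup>2 = a" by simp
    show "s + (s - r) + (s - q) + (s - p) = b" using b by simp
  qed
qed

text \<open>An even sum allows the entries to be paired with equal parities, and
  \<open>a\<^sup>2 + b\<^sup>2\<close> is twice the sum of the squares of \<open>(a + b) / 2\<close>
  and \<open>(a - b) / 2\<close>.\<close>

lemma double_four_squares:
  fixes n a b c d :: int
  assumes eq: "2 * n = a\<^sup>2 + b\<^sup>2 + c\<^sup>2 + d\<^sup>2"
  shows "\<exists>a b c d. n = a\<^sup>2 + b\<^sup>2 + c\<^sup>2 + d\<^sup>2"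
proof -
  have half: "\<exists>p q. a\<^sup>2 + b\<^sup>2 = 2 * (p\<^sup>2 + q\<^sup>2)" if ev: "even (a + b)" for a b :: int
  proof -
    obtain p where p: "a + b = 2 * p" using ev by (rule evenE)
    have a: "a = 2 * p - b" using p by simp
    have "a\<^sup>2 + b\<^sup>2 = 2 * (p\<^sup>2 + (p - b)\<^sup>2)"
      unfolding a by (simp add: power2_eq_square algebra_simps)
    then show ?thesis by blast
  qed
  have *: "\<exists>a b c d. n = a\<^sup>2 + b\<^sup>2 + c\<^sup>2 + d\<^sup>2"
    if sum: "2 * n = a\<^sup>2 + b\<^sup>2 + c\<^sup>2 + d\<^sup>2" and ev: "even (a + b)" "even (c + d)" for a b c d :: int
  proof -
    obtain p q r s where "a\<^sup>2 + b\<^sup>2 = 2 * (p\<^sup>2 + q\<^sup>2)" "c\<^sup>2 + d\<^sup>2 = 2 * (r\<^sup>2 + s\<^sup>2)"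
      using half[OF ev(1)] half[OF ev(2)] by blast
    then have "n = p\<^sup>2 + q\<^sup>2 + r\<^sup>2 + s\<^sup>2" using sum unfolding distrib_left by linarith
    then show ?thesis by blast
  qed
  have "even (a\<^sup>2 + b\<^sup>2 + c\<^sup>2 + d\<^sup>2)" using eq by (metis dvd_triv_left)
  then have "even (a + b + c + d)" by simp
  then have "even (a + b) \<and> even (c + d) \<or> even (a + c) \<and> even (b + d) \<or> even (a + d) \<and> even (b + c)"
    by presburger
  moreover have "2 * n = a\<^sup>2 + c\<^sup>2 + b\<^sup>2 + d\<^sup>2" "2 * n = a\<^sup>2 + d\<^sup>2 + b\<^sup>2 + c\<^sup>2"
    using eq by simp_all
  ultimately show ?thesis
    using *[OF eq] *[of a c b d] *[of a d b c] by blast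
qed

text \<open>For odd \<open>n = 2 * k + 1\<close>, the number \<open>4 * n = (8 * k + 3) + 1\<close>
  is a sum of four squares, and halving twice gives \<open>n\<close>. Even numbers follow by
  doubling: \<open>2 * (a\<^sup>2 + b\<^sup>2) = (a + b)\<^sup>2 + (a - b)\<^sup>2\<close>.\<close>

lemma four_squares:
  fixes n :: int
  assumes "0 \<le> n"
  shows "\<exists>a b c d. n = a\<^sup>2 + b\<^sup>2 + c\<^sup>2 + d\<^sup>2"
proof -
  have odd: "\<exists>a b c d. int (2 * k + 1) = a\<^sup>2 + b\<^sup>2 + c\<^sup>2 + d\<^sup>2" for k
  proof -
    obtain x y z :: int where "x\<^sup>2 + y\<^sup>2 + z\<^sup>2 = 8 * int k + 3" by (rule three_odd_squares)
    then have "2 * (2 * int (2 * k + 1)) = x\<^sup>2 + y\<^sup>2 + z\<^sup>2 + 1\<^sup>2" by simp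
    then obtain a b c d where "2 * int (2 * k + 1) = a\<^sup>2 + b\<^sup>2 + c\<^sup>2 + d\<^sup>2"
      using double_four_squares by blast
    then show ?thesis by (rule double_four_squares)
  qed
  have "\<exists>a b c d. int k = a\<^sup>2 + b\<^sup>2 + c\<^sup>2 + d\<^sup>2" for k
  proof (induction k rule: less_induct)
    case (less k)
    consider "k = 0" | "odd k" | "k = 2 * (k div 2)" "k div 2 < k" by fastforce
    then show ?case
    proof cases
      case 1
      then show ?thesis by (intro exI[of _ 0]) simp
    next
      case 2
      then show ?thesis using odd by (auto elim!: oddE)
    next
      case 3
      then obtain a b c d where "int (k div 2) = a\<^sup>2 + b\<^sup>2 + c\<^sup>2 + d\<^sup>2" using less.IH by blast
      then have "int k = (a + b)\<^sup>2 + (a - b)\<^sup>2 + (c + d)\<^sup>2 + (c - d)\<^sup>2"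
        by (subst 3(1)) (simp add: power2_eq_square algebra_simps)
      then show ?thesis by blast
    qed
  qed
  then show ?thesis using assms by (metis int_nat_eq)
qed

section \<open>Sums of generalized polygonal numbers\<close>

lemma two_polygonal: "2 * polygonal m x = (int m - 2) * (x\<^sup>2 - x) + 2 * x"
proof -
  have "even ((int m - 2) * x\<^sup>2 - (int m - 4) * x)" by simp
  then have "2 * polygonal m x = (int m - 2) * x\<^sup>2 - (int m - 4) * x"
    unfolding polygonal_def by (rule dvd_mult_div_cancel)
  then show ?thesis by (simp add: algebra_simps)
qed

lemma polygonal_eqI: "(int m - 2) * (x\<^sup>2 - x) + 2 * x = 2 * c \<Longrightarrow> polygonal m x = c"
  using two_polygonal[of m x] by simp

lemma polygonal_simps [simp]:
  "polygonal m 0 = 0" "polygonal m 1 = 1" "polygonal m (-1) = int m - 3" "polygonal m 2 = int m"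
  "polygonal m (-2) = 3 * int m - 8" "polygonal m 3 = 3 * int m - 3"
  by (rule polygonal_eqI; simp)+

lemma polygonal_pos_ge:
  assumes "3 \<le> m" "2 \<le> k" "k \<le> x"
  shows "polygonal m k \<le> polygonal m x"
proof -
  have "k * k \<le> x * x" using assms by (intro mult_mono) auto
  moreover have "0 \<le> (x - k) * (x + k - 1)" using assms by simp
  then have "0 \<le> (x\<^sup>2 - x) - (k\<^sup>2 - k)" by (simp add: power2_eq_square algebra_simps)
  then have "(int m - 2) * (k\<^sup>2 - k) \<le> (int m - 2) * (x\<^sup>2 - x)"
    using assms by (intro mult_left_mono) auto
  ultimately show ?thesis using two_polygonal[of m x] two_polygonal[of m k] assms by linarith
qed

lemma polygonal_neg_ge:
  assumes "3 \<le> m" "k \<le> -1" "x \<le> k"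
  shows "polygonal m k \<le> polygonal m x"
proof -
  have "0 \<le> (k - x) * (- x - k - 1)" using assms by simp
  then have "2 * (k - x) \<le> (x\<^sup>2 - x) - (k\<^sup>2 - k)" by (simp add: power2_eq_square algebra_simps)
  then have "1 * (2 * (k - x)) \<le> (int m - 2) * ((x\<^sup>2 - x) - (k\<^sup>2 - k))"
    using assms by (intro mult_mono) auto
  then show ?thesis using two_polygonal[of m x] two_polygonal[of m k] assms
    by (simp add: right_diff_distrib)
qed

text \<open>The four values belong to 0, 1, -1 and 2. By monotonicity on either side the rest is
  bounded by the values \<open>3 * m - 8\<close> at -2 and \<open>3 * m - 3\<close> at 3.\<close>

lemma polygonal_cases:
  assumes "3 \<le> m"
  shows "polygonal m x \<in> {0, 1, int m - 3, int m} \<or> 3 * int m - 8 \<le> polygonal m x"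
proof -
  consider "x = 0" | "x = 1" | "x = -1" | "x = 2" | "x \<le> -2" | "3 \<le> x" by linarith
  then show ?thesis
  proof cases
    case 5
    then show ?thesis using polygonal_neg_ge[of m "-2" x] assms by simp
  next
    case 6
    then show ?thesis using polygonal_pos_ge[of m 3 x] assms by simp
  qed simp_all
qed

lemma polygonal_nonneg: "3 \<le> m \<Longrightarrow> 0 \<le> polygonal m x"
  using polygonal_cases[of m x] by auto

text \<open>A form with coefficients 1 and \<open>r\<close> has the values \<open>A + r * B\<close>
  with \<open>A\<close> and \<open>B\<close> in two such sets (\<open>represents_iff\<close>), so
  all later arguments are about these sets.\<close>

definition poly_sums :: "nat \<Rightarrow> nat \<Rightarrow> int set" where
  "poly_sums m k = {N. \<exists>x :: nat \<Rightarrow> int. N = (\<Sum>i<k. polygonal m (x i))}"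

lemma poly_sums_0 [simp]: "poly_sums m 0 = {0}"
  by (simp add: poly_sums_def)

lemma poly_sums_Suc: "N \<in> poly_sums m (Suc k) \<longleftrightarrow> (\<exists>A\<in>poly_sums m k. \<exists>y. N = A + polygonal m y)"
proof
  assume "N \<in> poly_sums m (Suc k)"
  then show "\<exists>A\<in>poly_sums m k. \<exists>y. N = A + polygonal m y" by (auto simp: poly_sums_def)
next
  assume "\<exists>A\<in>poly_sums m k. \<exists>y. N = A + polygonal m y"
  then obtain x y where "N = (\<Sum>i<k. polygonal m (x i)) + polygonal m y" by (auto simp: poly_sums_def)
  then have "N = (\<Sum>i<Suc k. polygonal m ((x(k := y)) i))" by simp
  then show "N \<in> poly_sums m (Suc k)" unfolding poly_sums_def by blast
qed

lemma poly_sums_1: "N \<in> poly_sums m (Suc 0) \<longleftrightarrow> (\<exists>x. N = polygonal m x)"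
  by (simp add: poly_sums_Suc)

lemma poly_sums_2: "N \<in> poly_sums m 2 \<longleftrightarrow> (\<exists>x y. N = polygonal m x + polygonal m y)"
  by (simp only: numeral_2_eq_2 poly_sums_Suc[of _ _ "Suc 0"] Bex_def poly_sums_1) blast

lemma poly_sums_3: "N \<in> poly_sums m 3 \<longleftrightarrow> (\<exists>x y z. N = polygonal m x + polygonal m y + polygonal m z)"
proof -
  have "3 = Suc 2" by simp
  then show ?thesis unfolding poly_sums_Suc[of _ _ 2] by (simp only: poly_sums_Suc Bex_def poly_sums_2) blast
qed

lemma poly_sums_4: "N \<in> poly_sums m 4 \<longleftrightarrow>
  (\<exists>x y z w. N = polygonal m x + polygonal m y + polygonal m z + polygonal m w)"
proof -
  have "4 = Suc 3" by simp
  then show ?thesis by (simp only: poly_sums_Suc Bex_def poly_sums_3) blast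
qed

lemma sum_lessThan_add: "(\<Sum>i<s + t. f i) = (\<Sum>i<s. f i) + (\<Sum>i<t. f (s + i))"
  for f :: "nat \<Rightarrow> int"
  by (induction t) auto

lemma poly_sums_add: "A \<in> poly_sums m j \<Longrightarrow> B \<in> poly_sums m k \<Longrightarrow> A + B \<in> poly_sums m (j + k)"
proof (induction k arbitrary: B)
  case (Suc k)
  then obtain C y where "C \<in> poly_sums m k" "B = C + polygonal m y" by (auto simp: poly_sums_Suc)
  then have "A + C \<in> poly_sums m (j + k)" "A + B = A + C + polygonal m y"
    using Suc.IH Suc.prems by auto
  then show ?case unfolding add_Suc_right poly_sums_Suc by blast
qed simp

lemma zero_in_sums: "0 \<in> poly_sums m k"
  by (auto simp: poly_sums_def intro!: exI[of _ "\<lambda>_. 0"])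

lemma poly_sums_mono: "A \<in> poly_sums m j \<Longrightarrow> j \<le> k \<Longrightarrow> A \<in> poly_sums m k"
  using poly_sums_add[OF _ zero_in_sums, of A m j "k - j"] by simp

lemma small_in_poly_sums:
  assumes "0 \<le> f" "f \<le> int k"
  shows "f \<in> poly_sums m k"
proof -
  have "int n \<in> poly_sums m n" for n
  proof (induction n)
    case (Suc n)
    show ?case unfolding poly_sums_Suc by (rule bexI[OF exI[of _ 1] Suc.IH]) simp
  qed simp
  from this[of "nat f"] have "f \<in> poly_sums m (nat f)" using assms by simp
  then show ?thesis by (rule poly_sums_mono) (use assms in simp)
qed

lemma represents_iff:
  "represents m (replicate s 1 @ replicate t r) N \<longleftrightarrow>
     (\<exists>A\<in>poly_sums m s. \<exists>B\<in>poly_sums m t. N = A + int r * B)"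
proof -
  let ?c = "replicate s 1 @ replicate t r"
  have sum: "(\<Sum>k<length ?c. int (?c ! k) * polygonal m (x k)) =
      (\<Sum>k<s. polygonal m (x k)) + int r * (\<Sum>k<t. polygonal m (x (s + k)))" for x
    by (simp add: sum_lessThan_add nth_append sum_distrib_left)
  show ?thesis
  proof
    assume "represents m ?c N"
    then obtain x where "N = (\<Sum>k<s. polygonal m (x k)) + int r * (\<Sum>k<t. polygonal m (x (s + k)))"
      unfolding represents_def sum by blast
    moreover have "(\<Sum>k<s. polygonal m (x k)) \<in> poly_sums m s"
      "(\<Sum>k<t. polygonal m (x (s + k))) \<in> poly_sums m t"
      unfolding poly_sums_def by (rule CollectI, rule exI, rule refl)+
    ultimately show "\<exists>A\<in>poly_sums m s. \<exists>B\<in>poly_sums m t. N = A + int r * B" by blast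
  next
    assume "\<exists>A\<in>poly_sums m s. \<exists>B\<in>poly_sums m t. N = A + int r * B"
    then obtain x y where xy: "N = (\<Sum>k<s. polygonal m (x k)) + int r * (\<Sum>k<t. polygonal m (y k))"
      unfolding poly_sums_def by auto
    show "represents m ?c N"
      unfolding represents_def sum
      by (rule exI[of _ "\<lambda>k. if k < s then x k else y (k - s)"]) (simp add: xy)
  qed
qed

lemma represents_ones_iff: "represents m (replicate n 1) N \<longleftrightarrow> N \<in> poly_sums m n"
  using represents_iff[of m n 0 0 N] by simp

lemma ell_eqI:
  assumes "\<And>N. 0 < N \<Longrightarrow> N \<in> poly_sums m n" "\<And>n'. \<forall>N>0. N \<in> poly_sums m n' \<Longrightarrow> n \<le> n'"
  shows "ell m = enat n"
  unfolding ell_def universal_def represents_ones_iff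
  by (rule Inf_eqI) (use assms in \<open>auto intro: Inf_lower\<close>)

lemma ell_ones_eqI:
  assumes up: "\<And>N. 0 < N \<Longrightarrow> \<exists>A\<in>poly_sums m s. \<exists>B\<in>poly_sums m k. N = A + int r * B"
    and low: "\<And>k'. (\<And>N. 0 < N \<Longrightarrow> \<exists>A\<in>poly_sums m s. \<exists>B\<in>poly_sums m k'. N = A + int r * B) \<Longrightarrow> k \<le> k'"
  shows "ell_ones m r s = enat (s + k)"
  unfolding ell_ones_def universal_def represents_iff
proof (rule Inf_eqI)
  fix i assume "i \<in> {enat n |n. s \<le> n \<and> (\<forall>N>0. \<exists>A\<in>poly_sums m s. \<exists>B\<in>poly_sums m (n - s). N = A + int r * B)}"
  then obtain n where n: "i = enat n" "s \<le> n" and N: "\<forall>N>0. \<exists>A\<in>poly_sums m s. \<exists>B\<in>poly_sums m (n - s). N = A + int r * B"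
    by auto
  have "k \<le> n - s" by (rule low) (use N in blast)
  then show "enat (s + k) \<le> i" using n by simp
next
  fix y assume "\<And>i. i \<in> {enat n |n. s \<le> n \<and> (\<forall>N>0. \<exists>A\<in>poly_sums m s. \<exists>B\<in>poly_sums m (n - s). N = A + int r * B)} \<Longrightarrow> y \<le> i"
  from this[of "enat (s + k)"] show "y \<le> enat (s + k)" using up by auto
qed

lemma poly_sums_nonneg:
  assumes "3 \<le> m" "B \<in> poly_sums m t"
  shows "0 \<le> B"
  using assms by (auto simp: poly_sums_def intro!: sum_nonneg polygonal_nonneg)

text \<open>Below \<open>m - 3\<close> every summand must be 0 or 1. This is the source of the lower
  bounds for large \<open>m\<close> and for the forms with coefficient \<open>r\<close>.\<close>

lemma poly_sums_le:
  assumes "3 \<le> m" "B \<in> poly_sums m t" "B < int m - 3"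
  shows "B \<le> int t"
  using assms(2,3)
proof (induction t arbitrary: B)
  case (Suc t)
  then obtain A y where A: "A \<in> poly_sums m t" and B: "B = A + polygonal m y" by (auto simp: poly_sums_Suc)
  have "0 \<le> A" "0 \<le> polygonal m y" using A assms(1) poly_sums_nonneg polygonal_nonneg by auto
  then have "polygonal m y < int m - 3" "A < int m - 3" using B Suc.prems(2) by auto
  moreover then have "polygonal m y \<le> 1" using polygonal_cases[OF assms(1), of y] assms(1) by auto
  ultimately show ?case using Suc.IH[OF A] B by simp
qed simp

text \<open>Four variables with sum \<open>b\<close> and sum of squares \<open>a\<close> give
  \<open>(m - 2) * (a - b) / 2 + b\<close>. Cauchy's lemma is applied with
  \<open>a = 2 * c + b\<close>, for which \<open>b\<^sup>2 < 4 * a\<close> is the stated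
  inequality.\<close>

lemma four_in_poly_sums:
  assumes "odd b" "(b - 2)\<^sup>2 < 8 * c + 4"
  shows "(int m - 2) * c + b \<in> poly_sums m 4"
proof -
  have "b\<^sup>2 < 4 * (2 * c + b)" using assms(2) by (simp add: power2_eq_square algebra_simps)
  then obtain s t u v where sq: "s\<^sup>2 + t\<^sup>2 + u\<^sup>2 + v\<^sup>2 = 2 * c + b" and sum: "s + t + u + v = b"
    using assms(1) by (elim cauchy_lemma[rotated 2]) auto
  have "2 * (polygonal m s + polygonal m t + polygonal m u + polygonal m v) =
      (int m - 2) * ((s\<^sup>2 + t\<^sup>2 + u\<^sup>2 + v\<^sup>2) - (s + t + u + v)) + 2 * (s + t + u + v)"
    unfolding distrib_left two_polygonal by (simp add: algebra_simps)
  also have "\<dots> = 2 * ((int m - 2) * c + b)"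
    unfolding sq sum by (simp add: algebra_simps)
  finally have "(int m - 2) * c + b = polygonal m s + polygonal m t + polygonal m u + polygonal m v" by simp
  then show ?thesis unfolding poly_sums_4 by blast
qed

lemma four_in_poly_sums':
  assumes "odd b" "\<bar>b - 2\<bar> \<le> d" "d\<^sup>2 < 8 * c + 4"
  shows "(int m - 2) * c + b \<in> poly_sums m 4"
proof (rule four_in_poly_sums[OF assms(1)])
  have "(b - 2)\<^sup>2 \<le> d\<^sup>2" using assms(2) by (metis abs_ge_zero abs_le_square_iff abs_of_nonneg order_trans)
  then show "(b - 2)\<^sup>2 < 8 * c + 4" using assms(3) by simp
qed

text \<open>Odd \<open>b\<close> from -1 to 5 satisfies
  \<open>(b - 2)\<^sup>2 \<le> 9 < 8 * c + 4\<close>. One spare variable bridges the gaps between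
  these \<open>b\<close>, and all \<open>k - 4\<close> of them extend the range up to
  \<open>5 + (k - 4)\<close>.\<close>

lemma in_poly_sums:
  assumes "5 \<le> k" "1 \<le> c" "-1 \<le> f" "f \<le> int k + 1"
  shows "(int m - 2) * c + f \<in> poly_sums m k"
proof -
  obtain b where b: "odd b" "-1 \<le> b" "b \<le> 5" "b \<le> f" "f \<le> b + (int k - 4)"
  proof -
    consider "5 < f" | "odd f" "f \<le> 5" | "even f" "f \<le> 5" by linarith
    then show ?thesis
    proof cases
      case 1
      then show ?thesis using that[of 5] assms by simp
    next
      case 2
      then show ?thesis using that[of f] assms by simp
    next
      case 3
      then have "0 \<le> f" using assms(3) by presburger
      then show ?thesis using that[of "f - 1"] 3 assms by simp
    qed
  qed
  have "(int m - 2) * c + b \<in> poly_sums m 4"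
    by (rule four_in_poly_sums'[where d = 3]) (use b assms in auto)
  moreover have "f - b \<in> poly_sums m (k - 4)" by (rule small_in_poly_sums) (use b assms in auto)
  ultimately have "(int m - 2) * c + b + (f - b) \<in> poly_sums m (4 + (k - 4))" by (rule poly_sums_add)
  then show ?thesis using assms(1) by simp
qed

section \<open>Forms with all coefficients equal to 1\<close>

lemma in_poly_sums_all:
  assumes "9 \<le> m" "0 \<le> N"
  shows "N \<in> poly_sums m (m - 4)"
proof -
  \<comment> \<open>Dividing \<open>N + 1\<close> instead of \<open>N\<close> moves the remainder to
    -1 up to \<open>m - 4\<close>, which \<open>m - 4\<close> zeros and ones can also reach when
    \<open>c = 0\<close>.\<close>
  define c where "c = (N + 1) div (int m - 2)"
  define f where "f = (N + 1) mod (int m - 2) - 1"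
  have "(int m - 2) * c + (f + 1) = N + 1" by (simp add: c_def f_def)
  then have N: "N = (int m - 2) * c + f" by simp
  have f: "-1 \<le> f" "f \<le> int m - 4"
    using pos_mod_bound[of "int m - 2" "N + 1"] pos_mod_sign[of "int m - 2" "N + 1"] assms(1)
    unfolding f_def by linarith+
  have "0 \<le> c" using assms unfolding c_def by (simp add: pos_imp_zdiv_nonneg_iff)
  then consider "c = 0" | "1 \<le> c" by linarith
  then show ?thesis
  proof cases
    case 1
    then show ?thesis using N f assms by (intro small_in_poly_sums) auto
  next
    case 2
    then show ?thesis unfolding N using f assms by (intro in_poly_sums) auto
  qed
qed

lemma ell_ge_9:
  assumes "9 \<le> m"
  shows "ell m = enat (m - 4)"
proof (rule ell_eqI)
  show "N \<in> poly_sums m (m - 4)" if "0 < N" for N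
    using in_poly_sums_all[OF assms] that by simp
  show "m - 4 \<le> n" if "\<forall>N>0. N \<in> poly_sums m n" for n
  proof -
    \<comment> \<open>The largest number below \<open>m - 3\<close>, hence a sum of zeros and ones
      only.\<close>
    have "int m - 4 \<in> poly_sums m n" using that assms by simp
    then have "int m - 4 \<le> int n" using assms by (intro poly_sums_le[of m]) auto
    then show ?thesis by simp
  qed
qed

lemma minimal_rank:
  assumes "\<forall>N>0. N \<in> poly_sums m n" "0 < N" "N \<notin> poly_sums m k"
  shows "Suc k \<le> n"
  using assms poly_sums_mono[of N m n k] by (meson not_less_eq_eq)

section \<open>The exceptional cases, m from 3 to 8\<close>

lemma ell_3: "ell 3 = enat 3"
proof (rule ell_eqI)
  fix N :: int assume "0 < N"
  obtain x y z where odd: "odd x" "odd y" "odd z" and eq: "x\<^sup>2 + y\<^sup>2 + z\<^sup>2 = 8 * int (nat N) + 3"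
    by (rule three_odd_squares)
  \<comment> \<open>Completing the square:
    \<open>(2 * a + 1)\<^sup>2 = 8 * polygonal 3 a + 1\<close>.\<close>
  obtain a b c where "x = 2 * a + 1" "y = 2 * b + 1" "z = 2 * c + 1" using odd by (metis oddE)
  then have "2 * N = 2 * (polygonal 3 a + polygonal 3 b + polygonal 3 c)"
    using eq \<open>0 < N\<close> unfolding distrib_left two_polygonal by (simp add: power2_eq_square algebra_simps)
  then have "N = polygonal 3 a + polygonal 3 b + polygonal 3 c" by simp
  then show "N \<in> poly_sums 3 3" unfolding poly_sums_3 by blast
next
  fix n assume "\<forall>N>0. N \<in> poly_sums 3 n"
  moreover have "5 \<notin> poly_sums 3 2"
  proof -
    have val: "polygonal 3 x \<in> {0, 1, 3}" if "polygonal 3 x \<le> 5" for x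
    proof -
      have "\<not> 3 \<le> x" using polygonal_pos_ge[of 3 3 x] that by auto
      moreover have "\<not> x \<le> -4"
        using polygonal_neg_ge[of 3 "-4" x] that by (auto simp: polygonal_eqI[of 3 "-4" 6])
      ultimately have "x \<in> {-3, -2, -1, 0, 1, 2}" by auto
      then show ?thesis by (auto simp: polygonal_eqI[of 3 "-3" 3])
    qed
    have False if "5 = polygonal 3 x + polygonal 3 y" for x y
      using val[of x] val[of y] that polygonal_nonneg[of 3 x] polygonal_nonneg[of 3 y] by auto
    then show ?thesis unfolding poly_sums_2 by blast
  qed
  ultimately show "3 \<le> n" using minimal_rank[of 3 n 5 2] by simp
qed

lemma polygonal_4: "polygonal 4 x = x\<^sup>2"
  by (simp add: polygonal_def)

lemma ell_4: "ell 4 = enat 4"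
proof (rule ell_eqI)
  show "N \<in> poly_sums 4 4" if "0 < N" for N
    using four_squares[of N] that by (simp add: poly_sums_4 polygonal_4)
  fix n assume "\<forall>N>0. N \<in> poly_sums 4 n"
  moreover have "7 \<notin> poly_sums 4 3"
  proof -
    have val: "polygonal 4 x \<in> {0, 1, 4}" if "polygonal 4 x \<le> 7" for x
    proof -
      have "\<not> 3 \<le> x" "\<not> x \<le> -3"
        using polygonal_pos_ge[of 4 3 x] polygonal_neg_ge[of 4 "-3" x] that by (auto simp: polygonal_4)
      then have "x \<in> {-2, -1, 0, 1, 2}" by auto
      then show ?thesis by (auto simp: polygonal_4)
    qed
    have False if "7 = polygonal 4 x + polygonal 4 y + polygonal 4 z" for x y z
      using val[of x] val[of y] val[of z] that
        polygonal_nonneg[of 4 x] polygonal_nonneg[of 4 y] polygonal_nonneg[of 4 z] by auto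
    then show ?thesis unfolding poly_sums_3 by blast
  qed
  ultimately show "4 \<le> n" using minimal_rank[of 4 n 7 3] by simp
qed

lemma three_dvd_square_diff: "3 dvd (x\<^sup>2 - (if 3 dvd x then 0 else 1))" for x :: int
proof -
  have "x\<^sup>2 - 1 = (x - 1) * (x + 1)" by (simp add: power2_eq_square algebra_simps)
  moreover have "3 dvd (x - 1) \<or> 3 dvd (x + 1)" if "\<not> 3 dvd x" using that by presburger
  ultimately show ?thesis by (auto simp: power2_eq_square)
qed

text \<open>
  If 3 divides all of \<open>x\<close>, \<open>y\<close>, \<open>z\<close>, divide by 3, and multiply back by the matrix with rows \<open>(-1, 2, 2)\<close>,
  \<open>(2, -1, 2)\<close>, \<open>(2, 2, -1)\<close>, which is 3 times an orthogonal matrix.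
\<close>

lemma three_odd_squares_descent:
  fixes x y z :: int
  assumes "odd x" "odd y" "odd z" "x\<^sup>2 + y\<^sup>2 + z\<^sup>2 = int M" "3 dvd M"
  shows "\<exists>x y z :: int. odd x \<and> odd y \<and> odd z \<and> \<not> 3 dvd x \<and> \<not> 3 dvd y \<and> \<not> 3 dvd z \<and>
    x\<^sup>2 + y\<^sup>2 + z\<^sup>2 = int M"
  using assms
proof (induction M arbitrary: x y z rule: less_induct)
  case (less M)
  let ?e = "\<lambda>x::int. if 3 dvd x then 0 else 1 :: int"
  have "3 dvd (x\<^sup>2 - ?e x) + (y\<^sup>2 - ?e y) + (z\<^sup>2 - ?e z)"
    by (intro dvd_add three_dvd_square_diff)
  moreover have "(x\<^sup>2 - ?e x) + (y\<^sup>2 - ?e y) + (z\<^sup>2 - ?e z) = int M - (?e x + ?e y + ?e z)"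
    using less.prems(4) by simp
  moreover have "3 dvd int M" using less.prems(5) by presburger
  \<comment> \<open>The number of coordinates prime to 3 is thus 0 or 3.\<close>
  ultimately have "3 dvd (?e x + ?e y + ?e z)" by (metis dvd_diff_right_iff)
  then consider "\<not> 3 dvd x" "\<not> 3 dvd y" "\<not> 3 dvd z" | "3 dvd x" "3 dvd y" "3 dvd z"
    by (auto split: if_splits)
  then show ?case
  proof cases
    case 1
    then show ?thesis using less.prems by blast
  next
    case 2
    then obtain a b c where abc: "x = 3 * a" "y = 3 * b" "z = 3 * c" unfolding dvd_def by blast
    have odd: "odd a" "odd b" "odd c" using less.prems abc by auto
    have M: "int M = 9 * (a\<^sup>2 + b\<^sup>2 + c\<^sup>2)" using less.prems(4) by (simp add: abc power_mult_distrib)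
    define L where "L = nat (a\<^sup>2 + b\<^sup>2 + c\<^sup>2)"
    have "0 < a\<^sup>2" "0 \<le> b\<^sup>2" "0 \<le> c\<^sup>2" using odd by auto
    then have L: "int L = a\<^sup>2 + b\<^sup>2 + c\<^sup>2" "0 < L" unfolding L_def by linarith+
    then have "int M = 9 * int L" using M by simp
    then have LM: "L < M" "M = 9 * L" using L(2) by linarith+
    \<comment> \<open>If 3 divides \<open>L = M / 9\<close>, the induction hypothesis applies;
      otherwise \<open>a\<close>, \<open>b\<close>, \<open>c\<close> cannot all be multiples of
      3.\<close>
    obtain p q r where pqr: "odd p" "odd q" "odd r" "p\<^sup>2 + q\<^sup>2 + r\<^sup>2 = int L" and some: "\<not> 3 dvd p \<or> \<not> 3 dvd q \<or> \<not> 3 dvd r"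
    proof (cases "3 dvd L")
      case True
      then show ?thesis using less.IH[OF LM(1) odd L(1)[symmetric]] that by blast
    next
      case False
      have "\<not> (3 dvd a \<and> 3 dvd b \<and> 3 dvd c)"
      proof
        assume "3 dvd a \<and> 3 dvd b \<and> 3 dvd c"
        then have "3 dvd int L" unfolding L by (auto intro!: dvd_add simp: power2_eq_square)
        then show False using False by presburger
      qed
      then show ?thesis using that[of a b c] odd L by auto
    qed
    obtain p' q' r' where pqr': "odd p'" "odd q'" "odd r'" "p'\<^sup>2 + q'\<^sup>2 + r'\<^sup>2 = int L" "\<not> 3 dvd (p' + q' + r')"
    proof -
      have flip: "\<not> 3 dvd (a + b) \<or> \<not> 3 dvd (b - a)" if "\<not> 3 dvd a" for a b :: int
        using that by presburger
      have "\<not> 3 dvd (p + q + r) \<or> \<not> 3 dvd (- p + q + r) \<or> \<not> 3 dvd (p + - q + r) \<or> \<not> 3 dvd (p + q + - r)"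
        using some flip[of p "q + r"] flip[of q "p + r"] flip[of r "p + q"] by (auto simp: algebra_simps)
      then consider "\<not> 3 dvd (p + q + r)" | "\<not> 3 dvd (- p + q + r)" | "\<not> 3 dvd (p + - q + r)" | "\<not> 3 dvd (p + q + - r)"
        by blast
      then show ?thesis
      proof cases
        case 1
        show ?thesis by (rule that[of p q r]) (use pqr 1 in simp_all)
      next
        case 2
        show ?thesis by (rule that[of "- p" q r]) (use pqr 2 in simp_all)
      next
        case 3
        show ?thesis by (rule that[of p "- q" r]) (use pqr 3 in simp_all)
      next
        case 4
        show ?thesis by (rule that[of p q "- r"]) (use pqr 4 in simp_all)
      qed
    qed
    let ?s = "p' + q' + r'"
    \<comment> \<open>The rows of the matrix; all three are \<open>2 * ?s\<close> modulo 3, which is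
      why the signs were chosen with \<open>?s\<close> prime to 3.\<close>
    let ?x = "2 * ?s - 3 * p'" and ?y = "2 * ?s - 3 * q'" and ?z = "2 * ?s - 3 * r'"
    have "?x\<^sup>2 + ?y\<^sup>2 + ?z\<^sup>2 = 9 * (p'\<^sup>2 + q'\<^sup>2 + r'\<^sup>2)"
      by (simp add: power2_eq_square algebra_simps)
    then have "?x\<^sup>2 + ?y\<^sup>2 + ?z\<^sup>2 = int M" using pqr'(4) LM by simp
    moreover have "odd ?x" "odd ?y" "odd ?z" using pqr' by simp_all
    moreover have "\<not> 3 dvd ?x" "\<not> 3 dvd ?y" "\<not> 3 dvd ?z" using pqr'(5) by presburger+
    ultimately show ?thesis by blast
  qed
qed

text \<open>Completing the square gives \<open>24 * polygonal 5 a + 1 = (6 * a - 1)\<^sup>2\<close>,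
  and every integer prime to 6 is \<open>6 * a - 1\<close> up to sign.\<close>

lemma odd_square_pentagonal:
  fixes x :: int
  assumes "odd x" "\<not> 3 dvd x"
  obtains a where "x\<^sup>2 = 24 * polygonal 5 a + 1"
proof -
  have *: "\<exists>a. y\<^sup>2 = 24 * polygonal 5 a + 1" if y: "odd y" "3 dvd (y + 1)" for y :: int
  proof -
    obtain k where k: "y + 1 = 3 * k" using y(2) by (rule dvdE)
    have "even (y + 1)" using y(1) by simp
    then have "even k" unfolding k by simp
    then obtain a where "k = 2 * a" by (rule evenE)
    then have y_eq: "y = 6 * a - 1" using k by simp
    have "y\<^sup>2 = 12 * (2 * polygonal 5 a) + 1"
      unfolding y_eq two_polygonal by (simp add: power2_eq_square algebra_simps)
    then show ?thesis by (intro exI[of _ a]) simp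
  qed
  have "3 dvd (x + 1) \<or> 3 dvd (- x + 1)" using assms(2) by presburger
  then show ?thesis using *[of x] *[of "- x"] assms(1) that by auto
qed

text \<open>The task is to write \<open>24 * N + 3 = 8 * (3 * N) + 3\<close> as three squares of
  numbers prime to 6. Gauss's theorem makes them odd, and the descent makes them prime to 3.\<close>

lemma ell_5: "ell 5 = enat 3"
proof (rule ell_eqI)
  fix N :: int assume "0 < N"
  obtain x y z where "odd x" "odd y" "odd z" and "x\<^sup>2 + y\<^sup>2 + z\<^sup>2 = 8 * int (nat (3 * N)) + 3"
    by (rule three_odd_squares)
  then have "\<exists>x y z :: int. odd x \<and> odd y \<and> odd z \<and> \<not> 3 dvd x \<and> \<not> 3 dvd y \<and> \<not> 3 dvd z \<and>
    x\<^sup>2 + y\<^sup>2 + z\<^sup>2 = int (24 * nat N + 3)"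
    using \<open>0 < N\<close> by (intro three_odd_squares_descent[of x y z]) (auto simp: nat_mult_distrib)
  then obtain x y z :: int where odd: "odd x" "odd y" "odd z" and ndvd: "\<not> 3 dvd x" "\<not> 3 dvd y" "\<not> 3 dvd z"
    and eq: "x\<^sup>2 + y\<^sup>2 + z\<^sup>2 = int (24 * nat N + 3)" by blast
  obtain a where a: "x\<^sup>2 = 24 * polygonal 5 a + 1" using odd(1) ndvd(1) by (rule odd_square_pentagonal)
  obtain b where b: "y\<^sup>2 = 24 * polygonal 5 b + 1" using odd(2) ndvd(2) by (rule odd_square_pentagonal)
  obtain c where c: "z\<^sup>2 = 24 * polygonal 5 c + 1" using odd(3) ndvd(3) by (rule odd_square_pentagonal)
  have "N = polygonal 5 a + polygonal 5 b + polygonal 5 c" using eq a b c \<open>0 < N\<close> by simp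
  then show "N \<in> poly_sums 5 3" unfolding poly_sums_3 by blast
next
  fix n assume "\<forall>N>0. N \<in> poly_sums 5 n"
  moreover have "11 \<notin> poly_sums 5 2"
  proof -
    have val: "polygonal 5 x \<in> {0, 1, 2, 5, 7}" if "polygonal 5 x \<le> 11" for x
    proof -
      have "\<not> 3 \<le> x" using polygonal_pos_ge[of 5 3 x] that by auto
      moreover have "\<not> x \<le> -3"
        using polygonal_neg_ge[of 5 "-3" x] that by (auto simp: polygonal_eqI[of 5 "-3" 15])
      ultimately have "x \<in> {-2, -1, 0, 1, 2}" by auto
      then show ?thesis by auto
    qed
    have False if "11 = polygonal 5 x + polygonal 5 y" for x y
      using val[of x] val[of y] that polygonal_nonneg[of 5 x] polygonal_nonneg[of 5 y] by auto
    then show ?thesis unfolding poly_sums_2 by blast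
  qed
  ultimately show "3 \<le> n" using minimal_rank[of 5 n 11 2] by simp
qed

text \<open>Here \<open>8 * polygonal 6 a + 1 = (4 * a - 1)\<^sup>2\<close>, and odd numbers are
  \<open>4 * a - 1\<close> up to sign.\<close>

lemma odd_square_hexagonal:
  fixes x :: int
  assumes "odd x"
  obtains a where "x\<^sup>2 = 8 * polygonal 6 a + 1"
proof -
  have *: "\<exists>a. y\<^sup>2 = 8 * polygonal 6 a + 1" if y: "4 dvd (y + 1)" for y :: int
  proof -
    obtain a where "y + 1 = 4 * a" using y by (rule dvdE)
    then have y_eq: "y = 4 * a - 1" by simp
    have "y\<^sup>2 = 4 * (2 * polygonal 6 a) + 1"
      unfolding y_eq two_polygonal by (simp add: power2_eq_square algebra_simps)
    then show ?thesis by (intro exI[of _ a]) simp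
  qed
  have "4 dvd (x + 1) \<or> 4 dvd (- x + 1)" using assms by presburger
  then show ?thesis using *[of x] *[of "- x"] that by auto
qed

lemma ell_6: "ell 6 = enat 3"
proof (rule ell_eqI)
  fix N :: int assume "0 < N"
  obtain x y z where odd: "odd x" "odd y" "odd z" and eq: "x\<^sup>2 + y\<^sup>2 + z\<^sup>2 = 8 * int (nat N) + 3"
    by (rule three_odd_squares)
  obtain a where a: "x\<^sup>2 = 8 * polygonal 6 a + 1" using odd(1) by (rule odd_square_hexagonal)
  obtain b where b: "y\<^sup>2 = 8 * polygonal 6 b + 1" using odd(2) by (rule odd_square_hexagonal)
  obtain c where c: "z\<^sup>2 = 8 * polygonal 6 c + 1" using odd(3) by (rule odd_square_hexagonal)
  have "N = polygonal 6 a + polygonal 6 b + polygonal 6 c" using eq a b c \<open>0 < N\<close> by simp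
  then show "N \<in> poly_sums 6 3" unfolding poly_sums_3 by blast
next
  fix n assume "\<forall>N>0. N \<in> poly_sums 6 n"
  moreover have "5 \<noteq> polygonal 6 x + polygonal 6 y" for x y
    using polygonal_cases[of 6 x] polygonal_cases[of 6 y] polygonal_nonneg[of 6 x] polygonal_nonneg[of 6 y]
    by auto
  then have "5 \<notin> poly_sums 6 2" unfolding poly_sums_2 by blast
  ultimately show "3 \<le> n" using minimal_rank[of 6 n 5 2] by simp
qed

lemma polygonal_values:
  assumes "3 \<le> m" "polygonal m x \<le> 3 * int m - 9"
  shows "polygonal m x \<in> {0, 1, int m - 3, int m}"
  using polygonal_cases[OF assms(1), of x] assms(2) by auto

text \<open>The odd values \<open>b = 5, 1, -3, 3, -1\<close> cover all residues modulo
  \<open>m - 2 = 5\<close>. The inequality of \<open>four_in_poly_sums\<close> fails only for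
  \<open>N = 2, 5, 7\<close>, which get explicit witnesses.\<close>

lemma ell_7: "ell 7 = enat 4"
proof (rule ell_eqI)
  fix N :: int assume "0 < N"
  have gen: "polygonal 7 a + polygonal 7 b + polygonal 7 c + polygonal 7 d \<in> poly_sums 7 4" for a b c d
    unfolding poly_sums_4 by blast
  have four: "5 * c + b \<in> poly_sums 7 4" if "odd b" "(b - 2)\<^sup>2 < 8 * c + 4" for b c
    using four_in_poly_sums[OF that, of 7] by simp
  define k where "k = N div 5"
  have "0 \<le> k" using \<open>0 < N\<close> by (simp add: k_def pos_imp_zdiv_nonneg_iff)
  have "N = 5 * k + N mod 5" "0 \<le> N mod 5" "N mod 5 < 5" by (simp_all add: k_def)
  then consider "N = 5 * k" | "N = 5 * k + 1" | "N = 5 * k + 2" | "N = 5 * k + 3" | "N = 5 * k + 4"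
    by linarith
  then show "N \<in> poly_sums 7 4"
  proof cases
    case 1
    show ?thesis
    proof (cases "k = 1")
      case True
      then show ?thesis using gen[of "-1" 1 0 0] 1 by simp
    next
      case False
      then show ?thesis using four[of 5 "k - 1"] 1 \<open>0 < N\<close> by simp
    qed
  next
    case 2
    then show ?thesis using four[of 1 k] \<open>0 \<le> k\<close> by simp
  next
    case 3
    consider "k = 0" | "k = 1" | "2 \<le> k" using \<open>0 \<le> k\<close> by linarith
    then show ?thesis
    proof cases
      case 1
      then show ?thesis using gen[of 1 1 0 0] 3 by simp
    next
      case 2
      then show ?thesis using gen[of 2 0 0 0] 3 by simp
    next
      case k: 3
      then show ?thesis using four[of "-3" "k + 1"] 3 by (simp add: add.commute)
    qed
  next
    case 4
    then show ?thesis using four[of 3 k] \<open>0 \<le> k\<close> by simp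
  next
    case 5
    then show ?thesis using four[of "-1" "k + 1"] \<open>0 \<le> k\<close> by (simp add: add.commute)
  qed
next
  fix n assume "\<forall>N>0. N \<in> poly_sums 7 n"
  moreover have "10 \<noteq> polygonal 7 x + polygonal 7 y + polygonal 7 z" for x y z
    using polygonal_values[of 7 x] polygonal_values[of 7 y] polygonal_values[of 7 z]
      polygonal_nonneg[of 7 x] polygonal_nonneg[of 7 y] polygonal_nonneg[of 7 z]
    by auto
  then have "10 \<notin> poly_sums 7 3" unfolding poly_sums_3 by blast
  ultimately show "4 \<le> n" using minimal_rank[of 7 n 10 3] by simp
qed

text \<open>Here \<open>3 * polygonal 8 a + 1 = (3 * a - 1)\<^sup>2\<close>.\<close>

lemma octagonal_square:
  fixes x :: int
  assumes "\<not> 3 dvd x"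
  obtains a where "x\<^sup>2 = 3 * polygonal 8 a + 1"
proof -
  have *: "\<exists>a. y\<^sup>2 = 3 * polygonal 8 a + 1" if y: "3 dvd (y + 1)" for y :: int
  proof -
    obtain a where "y + 1 = 3 * a" using y by (rule dvdE)
    then have y_eq: "y = 3 * a - 1" by simp
    have "2 * y\<^sup>2 = 3 * (2 * polygonal 8 a) + 2"
      unfolding y_eq two_polygonal by (simp add: power2_eq_square algebra_simps)
    then show ?thesis by (intro exI[of _ a]) simp
  qed
  have "3 dvd (x + 1) \<or> 3 dvd (- x + 1)" using assms by presburger
  then show ?thesis using *[of x] *[of "- x"] that by auto
qed

text \<open>The reflection in \<open>(1, 1, 1, 1)\<close>, which is integral on vectors with even coordinate sum.\<close>

lemma reflect_four_squares:
  fixes a b c d n :: int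
  assumes "a\<^sup>2 + b\<^sup>2 + c\<^sup>2 + d\<^sup>2 = n" "even n" "\<not> 3 dvd a" "3 dvd b" "3 dvd c" "3 dvd d"
  shows "\<exists>a b c d. a\<^sup>2 + b\<^sup>2 + c\<^sup>2 + d\<^sup>2 = n \<and> \<not> 3 dvd a \<and> \<not> 3 dvd b \<and> \<not> 3 dvd c \<and> \<not> 3 dvd d"
proof -
  have "even (a\<^sup>2 + b\<^sup>2 + c\<^sup>2 + d\<^sup>2)" using assms(1,2) by simp
  then have "even (a + b + c + d)" by simp
  then obtain h where h: "a + b + c + d = 2 * h" by (rule evenE)
  have a: "a = 2 * h - b - c - d" using h by simp
  have "\<not> 3 dvd h" using assms(3-6) unfolding a by presburger
  have "(a - h)\<^sup>2 + (b - h)\<^sup>2 + (c - h)\<^sup>2 + (d - h)\<^sup>2 = a\<^sup>2 + b\<^sup>2 + c\<^sup>2 + d\<^sup>2"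
    unfolding a by (simp add: power2_eq_square algebra_simps)
  moreover have "\<not> 3 dvd (b - h)" "\<not> 3 dvd (c - h)" "\<not> 3 dvd (d - h)"
    using \<open>\<not> 3 dvd h\<close> assms(4-6) by (simp_all add: dvd_diff_right_iff dvd_diff_left_iff)
  moreover have ah: "a - h = h - (b + c + d)" using a by simp
  have "\<not> 3 dvd (a - h)"
    unfolding ah using \<open>\<not> 3 dvd h\<close> dvd_diff_left_iff[of 3 "b + c + d" h] assms(4-6) by simp
  ultimately show ?thesis using assms(1) by metis
qed

text \<open>As \<open>m - 2 = 6\<close> is even, Cauchy's lemma reaches only odd \<open>N\<close>.
  For even \<open>N\<close>, write \<open>3 * N + 4\<close> as four squares; modulo 3, either four
  or one of the entries are prime to 3. The reflection repairs the second case.\<close>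

lemma ell_8: "ell 8 = enat 4"
proof (rule ell_eqI)
  fix N :: int assume "0 < N"
  show "N \<in> poly_sums 8 4"
  proof (cases "even N")
    case True
    obtain a b c d where eq: "a\<^sup>2 + b\<^sup>2 + c\<^sup>2 + d\<^sup>2 = 3 * N + 4"
      using four_squares[of "3 * N + 4"] \<open>0 < N\<close> by auto
    let ?e = "\<lambda>x::int. if 3 dvd x then 0 else 1 :: int"
    have "3 dvd (a\<^sup>2 - ?e a) + (b\<^sup>2 - ?e b) + (c\<^sup>2 - ?e c) + (d\<^sup>2 - ?e d)"
      by (intro dvd_add three_dvd_square_diff)
    moreover have "(a\<^sup>2 - ?e a) + (b\<^sup>2 - ?e b) + (c\<^sup>2 - ?e c) + (d\<^sup>2 - ?e d)
        = 3 * (N + 1) - (?e a + ?e b + ?e c + ?e d - 1)"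
      using eq by simp
    ultimately have "3 dvd (?e a + ?e b + ?e c + ?e d - 1)"
      by (metis dvd_diff_right_iff dvd_triv_left)
    then consider "\<not> 3 dvd a" "\<not> 3 dvd b" "\<not> 3 dvd c" "\<not> 3 dvd d"
      | "\<not> 3 dvd a" "3 dvd b" "3 dvd c" "3 dvd d" | "3 dvd a" "\<not> 3 dvd b" "3 dvd c" "3 dvd d"
      | "3 dvd a" "3 dvd b" "\<not> 3 dvd c" "3 dvd d" | "3 dvd a" "3 dvd b" "3 dvd c" "\<not> 3 dvd d"
      by (auto split: if_splits)
    moreover have "even (3 * N + 4)" using True by simp
    ultimately have "\<exists>a b c d. a\<^sup>2 + b\<^sup>2 + c\<^sup>2 + d\<^sup>2 = 3 * N + 4 \<and> \<not> 3 dvd a \<and> \<not> 3 dvd b \<and> \<not> 3 dvd c \<and> \<not> 3 dvd d"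
    proof cases
      case 1
      then show ?thesis using eq by blast
    next
      case 2
      show ?thesis by (rule reflect_four_squares[of a b c d]) (use 2 eq True in simp_all)
    next
      case 3
      show ?thesis by (rule reflect_four_squares[of b a c d]) (use 3 eq True in simp_all)
    next
      case 4
      show ?thesis by (rule reflect_four_squares[of c b a d]) (use 4 eq True in simp_all)
    next
      case 5
      show ?thesis by (rule reflect_four_squares[of d b c a]) (use 5 eq True in simp_all)
    qed
    then obtain a b c d where eq: "a\<^sup>2 + b\<^sup>2 + c\<^sup>2 + d\<^sup>2 = 3 * N + 4"
      and nd: "\<not> 3 dvd a" "\<not> 3 dvd b" "\<not> 3 dvd c" "\<not> 3 dvd d" by blast
    obtain p where p: "a\<^sup>2 = 3 * polygonal 8 p + 1" using nd(1) by (rule octagonal_square)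
    obtain q where q: "b\<^sup>2 = 3 * polygonal 8 q + 1" using nd(2) by (rule octagonal_square)
    obtain r where r: "c\<^sup>2 = 3 * polygonal 8 r + 1" using nd(3) by (rule octagonal_square)
    obtain s where s: "d\<^sup>2 = 3 * polygonal 8 s + 1" using nd(4) by (rule octagonal_square)
    have "N = polygonal 8 p + polygonal 8 q + polygonal 8 r + polygonal 8 s" using eq p q r s by simp
    then show ?thesis unfolding poly_sums_4 by blast
  next
    case False
    have four: "6 * c + b \<in> poly_sums 8 4" if "odd b" "(b - 2)\<^sup>2 < 8 * c + 4" for b c
      using four_in_poly_sums[OF that, of 8] by simp
    define k where "k = N div 6"
    have "0 \<le> k" using \<open>0 < N\<close> by (simp add: k_def pos_imp_zdiv_nonneg_iff)
    have "N = 6 * k + N mod 6" by (simp add: k_def)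
    moreover have "N mod 6 = 1 \<or> N mod 6 = 3 \<or> N mod 6 = 5" using False by presburger
    ultimately consider "N = 6 * k + 1" | "N = 6 * k + 3" | "N = 6 * k + 5" by linarith
    then show ?thesis
    proof cases
      case 1
      then show ?thesis using four[of 1 k] \<open>0 \<le> k\<close> by simp
    next
      case 2
      then show ?thesis using four[of 3 k] \<open>0 \<le> k\<close> by simp
    next
      case 3
      then show ?thesis using four[of "-1" "k + 1"] \<open>0 \<le> k\<close> by (simp add: add.commute)
    qed
  qed
next
  fix n assume "\<forall>N>0. N \<in> poly_sums 8 n"
  moreover have "4 \<noteq> polygonal 8 x + polygonal 8 y + polygonal 8 z" for x y z
    using polygonal_values[of 8 x] polygonal_values[of 8 y] polygonal_values[of 8 z]
      polygonal_nonneg[of 8 x] polygonal_nonneg[of 8 y] polygonal_nonneg[of 8 z]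
    by auto
  then have "4 \<notin> poly_sums 8 3" unfolding poly_sums_3 by blast
  ultimately show "4 \<le> n" using minimal_rank[of 8 n 4 3] by simp
qed

section \<open>Forms with coefficients 1 and r\<close>

lemma in_poly_sums':
  assumes "5 \<le> k" "0 \<le> c" "0 \<le> f" "f \<le> int k"
  shows "(int m - 2) * c + f \<in> poly_sums m k"
proof (cases "c = 0")
  case True
  then show ?thesis using small_in_poly_sums[OF assms(3,4)] by simp
next
  case False
  then show ?thesis by (intro in_poly_sums) (use assms in auto)
qed

lemma divide_by_period:
  assumes "3 \<le> m" "0 < N"
  obtains c e where "0 \<le> c" "0 \<le> e" "e \<le> int m - 3" "N = (int m - 2) * c + e"
proof (rule that[of "N div (int m - 2)" "N mod (int m - 2)"])
  have pos: "0 < int m - 2" using assms by simp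
  show "N mod (int m - 2) \<le> int m - 3" using pos_mod_bound[OF pos, of N] by linarith
  show "0 \<le> N mod (int m - 2)" using pos_mod_sign[OF pos] .
  show "0 \<le> N div (int m - 2)" using pos assms by (simp add: pos_imp_zdiv_nonneg_iff)
qed simp

lemma representationI:
  assumes "N = A + r * B" "A \<in> S" "B \<in> T"
  shows "\<exists>A\<in>S. \<exists>B\<in>T. N = A + r * B"
  using assms by blast

text \<open>The critical number is \<open>m - 2\<close>: the value \<open>m\<close> is too large for
  \<open>A\<close>, and \<open>A = m - 3\<close> would leave \<open>2 * B = 1\<close>.\<close>

lemma lower_bound_2:
  assumes m: "12 \<le> m" and k: "2 * int k + 2 \<le> int m"
    and rep: "\<And>N. 0 < N \<Longrightarrow> \<exists>A\<in>poly_sums m 1. \<exists>B\<in>poly_sums m k'. N = A + int 2 * B"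
  shows "k \<le> k'"
proof -
  obtain A B where A: "A \<in> poly_sums m (Suc 0)" and B: "B \<in> poly_sums m k'" and N: "int m - 2 = A + 2 * B"
    using rep[of "int m - 2"] m by auto
  obtain x where x: "A = polygonal m x" using A unfolding poly_sums_1 by blast
  have m3: "3 \<le> m" using m by simp
  have nonneg: "0 \<le> A" "0 \<le> B" using poly_sums_nonneg[OF m3] A B by blast+
  then have "B \<le> int k'" using N m by (intro poly_sums_le[OF _ B]) auto
  moreover have "A \<le> 1"
  proof -
    have "A \<in> {0, 1, int m - 3, int m}" unfolding x by (rule polygonal_values) (use x N nonneg m in auto)
    moreover have "2 * B \<noteq> 1" by presburger
    ultimately show ?thesis using N nonneg by auto
  qed
  ultimately show ?thesis using N k by linarith
qed

text \<open>With \<open>D = m - 2\<close>, an even multiple of \<open>D\<close> goes into the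
  variables with coefficient 2. An odd one leaves a single \<open>D\<close>, which the first
  variable absorbs as \<open>D - 1\<close> or \<open>D + 2\<close> according to the parity of
  \<open>e\<close>; for \<open>e = 0\<close> that \<open>D\<close> is itself a small
  remainder.\<close>

lemma ell_ones_2:
  assumes m: "12 \<le> m" and k: "2 * int k + 2 \<le> int m" "int m \<le> 2 * int k + 3"
  shows "ell_ones m 2 1 = enat (1 + k)"
proof (rule ell_ones_eqI)
  show "k \<le> k'" if "\<And>N. 0 < N \<Longrightarrow> \<exists>A\<in>poly_sums m 1. \<exists>B\<in>poly_sums m k'. N = A + int 2 * B" for k'
    using m k(1) that by (rule lower_bound_2)
next
  fix N :: int assume "0 < N"
  let ?D = "int m - 2"
  have k5: "5 \<le> k" using m k by linarith
  have P: "polygonal m x \<in> poly_sums m 1" for x by (auto simp: poly_sums_1)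
  obtain c e where ce: "0 \<le> c" "0 \<le> e" "e \<le> int m - 3" and N: "N = ?D * c + e"
    using divide_by_period[of m N] m \<open>0 < N\<close> by auto
  let ?goal = "\<exists>A\<in>poly_sums m 1. \<exists>B\<in>poly_sums m k. N = A + int 2 * B"
  have base: ?goal if "0 \<le> c'" "0 \<le> i" "i \<le> 2 * int k + 1" "N = 2 * (?D * c') + i" for c' i
  proof (rule representationI)
    show "N = i mod 2 + int 2 * (?D * c' + i div 2)" using that by simp
    show "i mod 2 \<in> poly_sums m 1" by (rule small_in_poly_sums) auto
    show "?D * c' + i div 2 \<in> poly_sums m k" by (rule in_poly_sums'[OF k5]) (use that in auto)
  qed
  show "\<exists>A\<in>poly_sums m 1. \<exists>B\<in>poly_sums m k. N = A + int 2 * B"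
  proof (cases "even c")
    case True
    then obtain c' where c': "c = 2 * c'" by (rule evenE)
    show ?thesis by (rule base[of c' e]) (use ce k c' N in auto)
  next
    case False
    then obtain c' where c': "c = 2 * c' + 1" by (rule oddE)
    have N': "N = 2 * (?D * c') + ?D + e" unfolding N c' by (simp add: algebra_simps)
    have "0 \<le> c'" using ce c' by simp
    show ?thesis
    proof (cases "odd e")
      case True
      then obtain f where f: "e = 2 * f + 1" by (rule oddE)
      show ?thesis
      proof (rule representationI)
        show "N = polygonal m (-1) + int 2 * (?D * c' + (f + 1))" using N' f by simp
        show "?D * c' + (f + 1) \<in> poly_sums m k"
          by (rule in_poly_sums'[OF k5]) (use ce f k \<open>0 \<le> c'\<close> in auto)
      qed (rule P)
    next
      case False
      then obtain f where f: "e = 2 * f" by (auto elim: evenE)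
      show ?thesis
      proof (cases "f = 0")
        case True
        show ?thesis by (rule base[of c' ?D]) (use N' True f k m \<open>0 \<le> c'\<close> in auto)
      next
        case False
        show ?thesis
        proof (rule representationI)
          show "N = polygonal m 2 + int 2 * (?D * c' + (f - 1))" using N' f by simp
          show "?D * c' + (f - 1) \<in> poly_sums m k"
            by (rule in_poly_sums'[OF k5]) (use ce f k False \<open>0 \<le> c'\<close> in auto)
        qed (rule P)
      qed
    qed
  qed
qed

text \<open>For \<open>m\<close> divisible by 3 the values 0, 1, \<open>m - 3\<close>,
  \<open>m\<close> are 0, 1, 0, 0 modulo 3, so \<open>A\<close> congruent to 2 forces
  \<open>A = 2\<close>. For \<open>m\<close> congruent to 1 they are 0, 1, 1, 1, so 3 dividing
  \<open>A\<close> forces \<open>A = 0\<close>. Either way \<open>B\<close> is at least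
  \<open>m - 4\<close>.\<close>

lemma ell_ones_3:
  assumes m: "10 \<le> m" "m mod 3 \<noteq> 2"
  shows "ell_ones m 3 2 = enat (2 + (m - 4))"
proof (rule ell_ones_eqI)
  fix N :: int assume "0 < N"
  show "\<exists>A\<in>poly_sums m 2. \<exists>B\<in>poly_sums m (m - 4). N = A + int 3 * B"
  proof (rule representationI)
    show "N = N mod 3 + int 3 * (N div 3)" by simp
    have "0 \<le> N mod 3" "N mod 3 < 3" by simp_all
    then show "N mod 3 \<in> poly_sums m 2" by (intro small_in_poly_sums) auto
    show "N div 3 \<in> poly_sums m (m - 4)"
      using m \<open>0 < N\<close> by (intro in_poly_sums_all) (auto simp: pos_imp_zdiv_nonneg_iff)
  qed
next
  fix k'
  assume rep: "\<And>N. 0 < N \<Longrightarrow> \<exists>A\<in>poly_sums m 2. \<exists>B\<in>poly_sums m k'. N = A + int 3 * B"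
  define t where "t = (if m mod 3 = 0 then 2 else 0 :: int)"
  have t: "t \<in> {0, 2}" by (simp add: t_def)
  obtain A B where A: "A \<in> poly_sums m 2" and B: "B \<in> poly_sums m k'" and N: "3 * int m - 12 + t = A + 3 * B"
    using rep[of "3 * int m - 12 + t"] m t by auto
  obtain x y where xy: "A = polygonal m x + polygonal m y" using A unfolding poly_sums_2 by blast
  have m3: "3 \<le> m" using m by simp
  have nonneg: "0 \<le> A" "0 \<le> B" "0 \<le> polygonal m x" "0 \<le> polygonal m y"
    using poly_sums_nonneg[OF m3] A B polygonal_nonneg[OF m3] by blast+
  then have Bk: "B \<le> int k'" using N m t by (intro poly_sums_le[OF _ B]) auto
  have vals: "polygonal m x \<in> {0, 1, int m - 3, int m}" "polygonal m y \<in> {0, 1, int m - 3, int m}"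
    by (rule polygonal_values; use xy N nonneg m t in auto)+
  have dvd: "3 dvd A - t"
  proof -
    have "A - t = 3 * (int m - 4 - B)" using N by simp
    then show ?thesis by simp
  qed
  have "A \<le> t"
  proof (cases "m mod 3 = 0")
    case True
    then have "int m = 3 * (int m div 3)" by presburger
    then obtain j where "int m = 3 * j" by blast
    then show ?thesis using vals dvd True unfolding xy t_def by (auto; presburger)
  next
    case False
    then have "m mod 3 = 1" using m by linarith
    then have "int m = 3 * (int m div 3) + 1" by presburger
    then obtain j where "int m = 3 * j + 1" by blast
    then show ?thesis using vals dvd False unfolding xy t_def by (auto; presburger)
  qed
  then have "3 * int m - 12 \<le> 3 * B" using N by simp
  then show "m - 4 \<le> k'" using Bk m by linarith
qed

text \<open>Now \<open>m - 3 = 3 * d - 1\<close> and \<open>m = 3 * d + 2\<close> are 2 modulo 3, so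
  the two unit variables can take over \<open>d\<close>, \<open>d + 1\<close> or
  \<open>2 * d - 1\<close> from \<open>e\<close> without changing the residue. At
  \<open>6 * d - 5\<close> only \<open>A = 1\<close> is possible, since two values
  \<open>m - 3\<close> are already too large.\<close>

lemma ell_ones_3_mod_2:
  assumes m: "int m = 3 * d + 2" "4 \<le> d" and k: "int k = 2 * d - 2"
  shows "ell_ones m 3 2 = enat (2 + k)"
proof (rule ell_ones_eqI)
  fix k'
  assume rep: "\<And>N. 0 < N \<Longrightarrow> \<exists>A\<in>poly_sums m 2. \<exists>B\<in>poly_sums m k'. N = A + int 3 * B"
  obtain A B where A: "A \<in> poly_sums m 2" and B: "B \<in> poly_sums m k'" and N: "6 * d - 5 = A + 3 * B"
    using rep[of "6 * d - 5"] m by auto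
  obtain x y where xy: "A = polygonal m x + polygonal m y" using A unfolding poly_sums_2 by blast
  have m3: "3 \<le> m" using m by linarith
  have nonneg: "0 \<le> A" "0 \<le> B" "0 \<le> polygonal m x" "0 \<le> polygonal m y"
    using poly_sums_nonneg[OF m3] A B polygonal_nonneg[OF m3] by blast+
  then have "B \<le> int k'" using N m by (intro poly_sums_le[OF m3 B]) auto
  moreover have "polygonal m x \<in> {0, 1, int m - 3, int m}" "polygonal m y \<in> {0, 1, int m - 3, int m}"
    by (rule polygonal_values[OF m3]; use xy N nonneg m in auto)+
  then have "A \<le> 1" using N nonneg xy m by (auto; presburger)
  ultimately show "k \<le> k'" using N k by linarith
next
  fix N :: int assume "0 < N"
  have m3: "3 \<le> m" and k5: "5 \<le> k" using m k by linarith+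
  have P: "polygonal m x + polygonal m y \<in> poly_sums m 2" for x y unfolding poly_sums_2 by blast
  define c where "c = N div 3 div (3 * d)"
  define e where "e = N div 3 mod (3 * d)"
  have N3: "N div 3 = 3 * d * c + e" by (simp add: c_def e_def)
  have c: "0 \<le> c" using \<open>0 < N\<close> m by (simp add: c_def pos_imp_zdiv_nonneg_iff)
  have e: "0 \<le> e" "e < 3 * d" using m by (simp_all add: e_def)
  let ?goal = "\<exists>A\<in>poly_sums m 2. \<exists>B\<in>poly_sums m k. N = A + int 3 * B"
  have rep: ?goal if "N = polygonal m x + polygonal m y + 3 * (3 * d * c + f)" "0 \<le> f" "f \<le> 2 * d - 2" for x y f
  proof (rule representationI)
    show "N = polygonal m x + polygonal m y + int 3 * (3 * d * c + f)" using that by simp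
    show "3 * d * c + f \<in> poly_sums m k" using in_poly_sums'[OF k5 c that(2), of m] that(3) k m by simp
  qed (rule P)
  have "N = 3 * (N div 3) + N mod 3" by simp
  then have N: "N = 3 * (3 * d * c) + 3 * e + N mod 3" unfolding N3 by simp
  have "N mod 3 = 0 \<or> N mod 3 = 1 \<or> N mod 3 = 2" by presburger
  then consider "N mod 3 = 0" | "N mod 3 = 1" | "N mod 3 = 2" by blast
  then show "\<exists>A\<in>poly_sums m 2. \<exists>B\<in>poly_sums m k. N = A + int 3 * B"
  proof cases
    case 1
    consider "e \<le> 2 * d - 2" | "2 * d - 2 < e" "e \<le> 3 * d - 2" | "e = 3 * d - 1" using e by linarith
    then show ?thesis
    proof cases
      case 1
      show ?thesis by (rule rep[of 0 0 e]) (use 1 \<open>N mod 3 = 0\<close> N e in auto)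
    next
      case 2
      show ?thesis by (rule rep[of 1 "-1" "e - d"]) (use 2 \<open>N mod 3 = 0\<close> N m in auto)
    next
      case 3
      show ?thesis by (rule rep[of 1 2 "e - d - 1"]) (use 3 \<open>N mod 3 = 0\<close> N m in auto)
    qed
  next
    case 2
    consider "e \<le> 2 * d - 2" | "2 * d - 2 < e" by linarith
    then show ?thesis
    proof cases
      case 1
      show ?thesis by (rule rep[of 1 0 e]) (use 1 \<open>N mod 3 = 1\<close> N e in auto)
    next
      case 2
      show ?thesis by (rule rep[of "-1" "-1" "e - 2 * d + 1"]) (use 2 \<open>N mod 3 = 1\<close> N m e in auto)
    qed
  next
    case 3
    consider "e \<le> 2 * d - 2" | "2 * d - 2 < e" "e \<le> 3 * d - 2" | "e = 3 * d - 1" using e by linarith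
    then show ?thesis
    proof cases
      case 1
      show ?thesis by (rule rep[of 1 1 e]) (use 1 \<open>N mod 3 = 2\<close> N e in auto)
    next
      case 2
      show ?thesis by (rule rep[of 2 0 "e - d"]) (use 2 \<open>N mod 3 = 2\<close> N m in auto)
    next
      case 3
      show ?thesis
      proof (rule representationI)
        \<comment> \<open>Here \<open>e\<close> is one below the period \<open>3 * d\<close>, so the
          offset -1 of \<open>in_poly_sums\<close> is used at \<open>c + 1\<close>.\<close>
        show "N = polygonal m 1 + polygonal m 1 + int 3 * ((int m - 2) * (c + 1) + - 1)"
          using N 3 \<open>N mod 3 = 2\<close> m by (simp add: algebra_simps)
        show "(int m - 2) * (c + 1) + - 1 \<in> poly_sums m k" by (rule in_poly_sums[OF k5]) (use c in auto)
      qed (rule P)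
    qed
  qed
qed

text \<open>Put \<open>D = m - 2\<close>. The unit variables absorb \<open>c' mod 4\<close> copies
  of \<open>D\<close> together with \<open>e\<close> modulo 4, using the values
  \<open>D - 1\<close>, \<open>D + 2\<close>, \<open>3 * D - 2\<close> and \<open>3 * D + 3\<close>;
  the ends of the range of \<open>f\<close> need other choices. For the lower bound at
  \<open>2 * m - 4\<close>, two large values would leave 1 or 2, not a multiple of 4.\<close>

lemma ell_ones_4:
  assumes k: "5 \<le> k" "4 * int k \<le> int m - 3" "int m - 2 \<le> 4 * int k + 4"
  shows "ell_ones m 4 3 = enat (3 + k)"
proof (rule ell_ones_eqI)
  fix k'
  assume rep: "\<And>N. 0 < N \<Longrightarrow> \<exists>A\<in>poly_sums m 3. \<exists>B\<in>poly_sums m k'. N = A + int 4 * B"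
  obtain A B where A: "A \<in> poly_sums m 3" and B: "B \<in> poly_sums m k'" and N: "2 * int m - 4 = A + 4 * B"
    using rep[of "2 * int m - 4"] k by auto
  obtain x y z where xyz: "A = polygonal m x + polygonal m y + polygonal m z" using A unfolding poly_sums_3 by blast
  have m3: "3 \<le> m" using k by linarith
  have nonneg: "0 \<le> A" "0 \<le> B" "0 \<le> polygonal m x" "0 \<le> polygonal m y" "0 \<le> polygonal m z"
    using poly_sums_nonneg[OF m3] A B polygonal_nonneg[OF m3] by blast+
  have Bk: "B \<le> int k'" by (rule poly_sums_le[OF m3 B]) (use N k nonneg in linarith)
  have vals: "polygonal m t \<in> {0, 1, int m - 3, int m}" if "polygonal m t \<le> A" for t
    by (rule polygonal_values[OF m3]) (use that N k nonneg in linarith)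
  have "int m - 6 \<le> 4 * B"
  proof -
    have "polygonal m x \<le> A" "polygonal m y \<le> A" "polygonal m z \<le> A" using xyz nonneg by linarith+
    then have "polygonal m x \<in> {0, 1, int m - 3, int m}" "polygonal m y \<in> {0, 1, int m - 3, int m}"
      "polygonal m z \<in> {0, 1, int m - 3, int m}" by (intro vals; simp)+
    moreover have "2 \<noteq> 4 * B" "1 \<noteq> 4 * B" by presburger+
    ultimately show ?thesis using N nonneg k unfolding xyz by auto
  qed
  then show "k \<le> k'" using Bk k by linarith
next
  fix N :: int assume "0 < N"
  let ?D = "int m - 2"
  let ?goal = "\<exists>A\<in>poly_sums m 3. \<exists>B\<in>poly_sums m k. N = A + int 4 * B"
  have "3 \<le> m" using k by linarith
  then obtain c' e where ce: "0 \<le> c'" "0 \<le> e" "e \<le> int m - 3" and Nc: "N = ?D * c' + e"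
    using divide_by_period[of m N] \<open>0 < N\<close> by blast
  define c where "c = c' div 4"
  have c: "0 \<le> c" using ce by (simp add: c_def pos_imp_zdiv_nonneg_iff)
  have "c' = 4 * c + c' mod 4" by (simp add: c_def)
  then have N: "N = 4 * (?D * c) + ?D * (c' mod 4) + e"
    using Nc by (metis distrib_left mult.left_commute)
  have rep: ?goal if "N = polygonal m x + polygonal m y + polygonal m z + 4 * (?D * c + f)"
    "0 \<le> f" "f \<le> int k" for x y z f
  proof (rule representationI)
    show "N = polygonal m x + polygonal m y + polygonal m z + int 4 * (?D * c + f)" using that by simp
    show "?D * c + f \<in> poly_sums m k" by (rule in_poly_sums'[OF k(1) c that(2,3)])
  qed (auto simp: poly_sums_3)
  have split4: "\<exists>f. 0 \<le> f \<and> f \<le> int k \<and> (e = 4 * f \<or> e = 4 * f + 1 \<or> e = 4 * f + 2 \<or> e = 4 * f + 3)"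
    if "0 \<le> e" "e \<le> 4 * int k + 3" for e
    by (rule exI[of _ "e div 4"]) (use that in presburger)
  have one: ?goal if "N = 4 * (?D * c) + ?D + e" "0 \<le> e" "e \<le> 4 * int k + 3" for e
    using split4[OF that(2,3)] that(1) rep[of "-1" 1 0] rep[of "-1" 1 1] rep[of 2 0 0] rep[of 2 1 0] by force
  obtain f where f: "0 \<le> f" "f \<le> int k" and "e = 4 * f \<or> e = 4 * f + 1 \<or> e = 4 * f + 2 \<or> e = 4 * f + 3"
    using split4[of e] ce k by auto
  then consider "e = 4 * f" | "e = 4 * f + 1" | "e = 4 * f + 2" | "e = 4 * f + 3" by blast
  note e_cases = this
  have "c' mod 4 = 0 \<or> c' mod 4 = 1 \<or> c' mod 4 = 2 \<or> c' mod 4 = 3" by presburger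
  then consider "c' mod 4 = 0" | "c' mod 4 = 1" | "c' mod 4 = 2" | "c' mod 4 = 3" by blast
  then show ?goal
  proof cases
    case c0: 1
    from e_cases show ?thesis
    proof cases
      case 1 then show ?thesis using rep[of 0 0 0 f] N c0 f by simp
    next
      case 2 then show ?thesis using rep[of 1 0 0 f] N c0 f by simp
    next
      case 3 then show ?thesis using rep[of 1 1 0 f] N c0 f by simp
    next
      case 4 then show ?thesis using rep[of 1 1 1 f] N c0 f by simp
    qed
  next
    case 2
    then show ?thesis using one[of e] N ce k by simp
  next
    case c2: 3
    from e_cases show ?thesis
    proof cases
      case e: 1
      \<comment> \<open>\<open>D + 2\<close> twice overshoots \<open>2 * D\<close> by 4, which needs
        \<open>f \<ge> 1\<close>. Otherwise one \<open>D\<close> is treated as the remainder, or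
        written as \<open>4 * k + 4\<close>.\<close>
      consider "f \<noteq> 0" | "f = 0" "?D \<le> 4 * int k + 3" | "f = 0" "?D = 4 * int k + 4" using k by linarith
      then show ?thesis
      proof cases
        case 1
        then show ?thesis using rep[of 2 2 0 "f - 1"] N c2 f e by simp
      next
        case 2
        then show ?thesis using one[of ?D] N c2 e k by simp
      next
        case 3
        then show ?thesis using rep[of 2 1 1 "int k"] N c2 e by simp
      qed
    next
      case 2
      then show ?thesis using rep[of 2 "-1" 0 f] N c2 f by simp
    next
      case 3
      then show ?thesis using rep[of 2 "-1" 1 f] N c2 f by simp
    next
      case e: 4
      show ?thesis
      proof (cases "f = int k")
        \<comment> \<open>Then \<open>e = 4 * k + 3 \<le> D - 1\<close> forces
          \<open>D = 4 * k + 4\<close>, and \<open>2 * D + e = (3 * D - 2) + 1\<close>.\<close>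
        case True
        then show ?thesis using rep[of "-2" 1 0 0] N c2 e ce k by simp
      next
        case False
        then show ?thesis using rep[of "-1" "-1" 1 "f + 1"] N c2 e f by simp
      qed
    qed
  next
    case c3: 4
    from e_cases show ?thesis
    proof cases
      case 1
      then show ?thesis using rep[of "-2" 1 1 f] N c3 f by simp
    next
      case 2
      then show ?thesis using rep[of 3 1 1 "f - 1"] rep[of "-1" "-1" "-1" 1] N c3 f k by (cases "f = 0") simp_all
    next
      case 3
      then show ?thesis using rep[of 2 2 2 "f - 1"] rep[of "-2" 0 0 1] N c3 f k by (cases "f = 0") simp_all
    next
      case 4
      then show ?thesis using rep[of 3 0 0 f] N c3 f by simp
    qed
  qed
qed

text \<open>At \<open>m - 4\<close> all variables contribute 0 or 1 times their coefficient, so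
  \<open>m - 4 \<le> (r - 1) + r * k'\<close>.\<close>

lemma lower_bound_ge_5:
  assumes r: "5 \<le> r" "r < m - 3" and k: "int r * int k < int m - 3"
    and rep: "\<And>N. 0 < N \<Longrightarrow> \<exists>A\<in>poly_sums m (r - 1). \<exists>B\<in>poly_sums m k'. N = A + int r * B"
  shows "k \<le> k'"
proof -
  have m3: "3 \<le> m" using r by simp
  have "0 < int m - 4" using r by linarith
  then obtain A B where A: "A \<in> poly_sums m (r - 1)" and B: "B \<in> poly_sums m k'"
    and N: "int m - 4 = A + int r * B" using rep by blast
  have nonneg: "0 \<le> A" "0 \<le> B" using poly_sums_nonneg[OF m3] A B by blast+
  then have "1 * B \<le> int r * B" using r by (intro mult_right_mono) auto
  then have "B \<le> int k'" using N nonneg by (intro poly_sums_le[OF m3 B]) auto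
  then have rB: "int r * B \<le> int r * int k'" by (intro mult_left_mono) auto
  have "0 \<le> int r * B" using nonneg by simp
  then have "A \<le> int (r - 1)" using N by (intro poly_sums_le[OF m3 A]) auto
  then have "int r * int k < int r * int k' + int r" using N k r rB by linarith
  then have "int r * int k < int r * (int k' + 1)" by (simp add: distrib_left)
  then have "int k < int k' + 1" using r by (simp only: mult_less_cancel_left_pos)
  then show ?thesis by simp
qed

text \<open>This serves \<open>r = 5\<close>, where the four unit variables leave none spare to
  reach even \<open>i\<close>. Both \<open>i - 5\<close> and \<open>i + 5\<close> are then odd, and
  the difference 5 is one variable with coefficient \<open>r\<close>. Their distance from 2 is at
  most 7, and \<open>49 < 8 * c + 4\<close> holds from \<open>c = 6\<close> on; smaller
  \<open>c\<close> get explicit witnesses.\<close>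

lemma four_in_poly_sums_near:
  assumes c: "1 \<le> c" and i: "-1 \<le> i" "i \<le> 4"
  shows "(int m - 2) * c + i \<in> poly_sums m 4 \<or>
    (int m - 2) * c + (i - 5) \<in> poly_sums m 4 \<and> (int m - 2) * c + (i + 5) \<in> poly_sums m 4"
proof -
  have gen: "N \<in> poly_sums m 4"
    if "N = polygonal m x + polygonal m y + polygonal m z + polygonal m w" for N x y z w
    using that unfolding poly_sums_4 by blast
  consider "odd i" | "even i" "6 \<le> c" | "even i" "c \<le> 5" by linarith
  then show ?thesis
  proof cases
    case 1
    then show ?thesis using c i by (intro disjI1 four_in_poly_sums'[where d = 3]) auto
  next
    case 2
    then have "0 \<le> i" using i by presburger
    then show ?thesis using 2 i
      by (intro disjI2 conjI four_in_poly_sums'[where d = 7]) auto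
  next
    case 3
    then have "i = 0 \<or> i = 2 \<or> i = 4" "c = 1 \<or> c = 2 \<or> c = 3 \<or> c = 4 \<or> c = 5"
      using i c by presburger+
    then show ?thesis
      using gen[of "int m - 2" 0 0 1 "-1"] gen[of "int m" 0 0 0 2] gen[of "int m + 2" 0 1 1 2]
        gen[of "2 * (int m - 2)" 1 1 "-1" "-1"] gen[of "2 * (int m - 2) + 2" 0 1 "-1" 2]
        gen[of "2 * (int m - 2) + 4" 0 0 2 2]
        gen[of "3 * (int m - 2)" 0 1 1 "-2"] gen[of "3 * (int m - 2) + 4" 0 0 1 3]
        gen[of "3 * (int m - 2) - 3" 0 "-1" "-1" "-1"] gen[of "3 * (int m - 2) + 7" 1 2 2 2]
        gen[of "4 * (int m - 2)" 0 0 2 "-2"] gen[of "4 * (int m - 2) + 2" 0 0 "-1" 3]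
        gen[of "4 * (int m - 2) + 4" 1 1 "-1" 3]
        gen[of "5 * (int m - 2)" 1 "-1" 2 "-2"] gen[of "5 * (int m - 2) + 2" 0 2 2 "-2"]
        gen[of "5 * (int m - 2) + 4" 0 "-1" 2 3]
      by (elim disjE) (simp_all add: algebra_simps)
  qed
qed

lemma ell_ones_ge_5:
  assumes r: "5 \<le> r" "r < m - 3" and k: "int r * int k < int m - 3" "int m - 3 \<le> int r * (int k + 1)"
  shows "ell_ones m r (r - 1) = enat (r - 1 + k)"
proof (rule ell_ones_eqI)
  show "k \<le> k'" if "\<And>N. 0 < N \<Longrightarrow> \<exists>A\<in>poly_sums m (r - 1). \<exists>B\<in>poly_sums m k'. N = A + int r * B" for k'
    using r k(1) that by (rule lower_bound_ge_5)
next
  fix N :: int assume "0 < N"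
  let ?D = "int m - 2"
  let ?goal = "\<exists>A\<in>poly_sums m (r - 1). \<exists>B\<in>poly_sums m k. N = A + int r * B"
  have k1: "1 \<le> k" using r k by (cases k) auto
  \<comment> \<open>The shift by 1 keeps \<open>e\<close> at most \<open>m - 4\<close>, so that its
    quotient by \<open>r\<close> stays within \<open>k\<close>.\<close>
  obtain c e' where c: "0 \<le> c" and e': "0 \<le> e'" "e' \<le> int m - 3" "N + 1 = ?D * c + e'"
    by (rule divide_by_period[of m "N + 1"]) (use r \<open>0 < N\<close> in auto)
  define e where "e = e' - 1"
  have e: "-1 \<le> e" "e \<le> int m - 4" and N: "N = ?D * c + e" using e' by (simp_all add: e_def)
  have rep: ?goal if "?D * c + i \<in> poly_sums m (r - 1)" "0 \<le> j" "j \<le> int k" "e = i + int r * j" for i j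
    by (rule representationI[OF _ that(1) small_in_poly_sums[OF that(2,3)]]) (use N that in simp)
  obtain i j where j: "0 \<le> j" "j \<le> int k" and i: "-1 \<le> i" "i \<le> int r - 1" "0 \<le> e \<Longrightarrow> 0 \<le> i"
    and eij: "e = i + int r * j"
  proof (cases "e = -1")
    case True
    then show ?thesis using that[of 0 "-1"] r by simp
  next
    case False
    have r0: "0 < int r" using r by simp
    have "e < int r * (int k + 1)" using e k by linarith
    moreover have "int r * (e div int r) \<le> e"
      using mult_div_mod_eq[of "int r" e] pos_mod_sign[OF r0, of e] by linarith
    ultimately have "int r * (e div int r) < int r * (int k + 1)" by linarith
    then have "e div int r < int k + 1" using r0 by (simp only: mult_less_cancel_left_pos)
    moreover have "0 \<le> e div int r" using e False r0 by (simp add: pos_imp_zdiv_nonneg_iff)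
    moreover have "e mod int r \<le> int r - 1" using pos_mod_bound[OF r0, of e] by linarith
    ultimately show ?thesis using that[of "e div int r" "e mod int r"] pos_mod_sign[OF r0, of e] by simp
  qed
  consider "c = 0" | "1 \<le> c" "6 \<le> r" | "1 \<le> c" "r = 5" using c r by linarith
  then show ?goal
  proof cases
    case 1
    then have "0 \<le> e" using N \<open>0 < N\<close> by simp
    then show ?thesis using 1 i r by (intro rep[OF _ j eij]) (auto intro: small_in_poly_sums)
  next
    case 2
    then show ?thesis using i by (intro rep[OF _ j eij] in_poly_sums) auto
  next
    case 3
    have "?D * c + i \<in> poly_sums m (r - 1) \<or>
      ?D * c + (i - 5) \<in> poly_sums m (r - 1) \<and> ?D * c + (i + 5) \<in> poly_sums m (r - 1)"
      using four_in_poly_sums_near[of c i m] 3 i by simp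
    then consider "?D * c + i \<in> poly_sums m (r - 1)"
      | "?D * c + (i - 5) \<in> poly_sums m (r - 1)" "?D * c + (i + 5) \<in> poly_sums m (r - 1)" by blast
    then show ?thesis
    proof cases
      case 1
      then show ?thesis by (rule rep[OF _ j eij])
    next
      case near: 2
      \<comment> \<open>The change of \<open>i\<close> by 5 is balanced by changing \<open>j\<close>
        by 1, downwards at the end \<open>j = k\<close> and upwards otherwise.\<close>
      show ?thesis
      proof (cases "j = int k")
        case True
        show ?thesis by (rule rep[OF near(2), of "j - 1"]) (use True k1 3 eij in auto)
      next
        case False
        show ?thesis by (rule rep[OF near(1), of "j + 1"]) (use False j 3 eij in auto)
      qed
    qed
  qed
qed

section \<open>Translation into the ceiling formulas\<close>

lemma ceiling_divide_bounds:
  fixes a r :: int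
  assumes "0 < r"
  shows "a \<le> r * \<lceil>real_of_int a / real_of_int r\<rceil>" "r * (\<lceil>real_of_int a / real_of_int r\<rceil> - 1) < a"
proof -
  let ?q = "(- a) div r"
  have q: "\<lceil>real_of_int a / real_of_int r\<rceil> = - ?q" by (rule ceiling_divide_eq_div)
  have "- a = r * ?q + (- a) mod r" by simp
  moreover have "0 \<le> (- a) mod r" "(- a) mod r < r" using assms by simp_all
  moreover have "r * (- ?q) = - (r * ?q)" "r * (- ?q - 1) = - (r * ?q) - r" by (simp_all add: algebra_simps)
  ultimately show "a \<le> r * \<lceil>real_of_int a / real_of_int r\<rceil>" "r * (\<lceil>real_of_int a / real_of_int r\<rceil> - 1) < a"
    unfolding q by linarith+
qed

lemma ell_ones_ge_5_ceiling:
  assumes r: "5 \<le> r" "r < m - 3"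
  shows "ell_ones m r (r - 1) = enat (nat \<lceil>(real m - 3) / real r\<rceil> + (r - 2))"
proof -
  define q where "q = \<lceil>(real m - 3) / real r\<rceil>"
  have q: "int m - 3 \<le> int r * q" "int r * (q - 1) < int m - 3"
    using ceiling_divide_bounds[of "int r" "int m - 3"] r by (simp_all add: q_def)
  have "1 < q"
  proof (rule ccontr)
    assume "\<not> 1 < q"
    then have "int r * q \<le> int r * 1" by (intro mult_left_mono) auto
    then show False using q r by linarith
  qed
  then have k: "int (nat (q - 1)) = q - 1" by simp
  have "ell_ones m r (r - 1) = enat (r - 1 + nat (q - 1))"
    by (rule ell_ones_ge_5[OF r]; unfold k) (use q in simp_all)
  also have "r - 1 + nat (q - 1) = nat q + (r - 2)" using \<open>1 < q\<close> r by linarith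
  finally show ?thesis by (simp add: q_def)
qed

lemma ell_ones_4_ceiling:
  assumes "62 \<le> m"
  shows "ell_ones m 4 3 = enat (nat \<lceil>(real m - 2) / 4\<rceil> + 2)"
proof -
  define q where "q = \<lceil>(real m - 2) / 4\<rceil>"
  have q: "int m - 2 \<le> 4 * q" "4 * (q - 1) < int m - 2"
    using ceiling_divide_bounds[of 4 "int m - 2"] by (simp_all add: q_def)
  have k: "int (nat (q - 1)) = q - 1" "5 \<le> nat (q - 1)" using q assms by linarith+
  have bounds: "4 * int (nat (q - 1)) \<le> int m - 3" "int m - 2 \<le> 4 * int (nat (q - 1)) + 4"
    unfolding k(1) using q by simp_all
  have "ell_ones m 4 3 = enat (3 + nat (q - 1))"
    by (rule ell_ones_4[OF k(2) bounds])
  also have "3 + nat (q - 1) = nat q + 2" using q assms by linarith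
  finally show ?thesis by (simp add: q_def)
qed

theorem theorem4p2:
  shows
    "(\<forall>m::nat. (9 \<le> m \<longrightarrow> ell m = enat (m - 4)) \<and>
               (m \<in> {3, 5, 6} \<longrightarrow> ell m = 3) \<and>
               (m \<in> {4, 7, 8} \<longrightarrow> ell m = 4)) \<and>
     (\<forall>m r::nat. 5 \<le> r \<and> r < m - 3 \<longrightarrow>
               ell_ones m r (r - 1) = enat (nat \<lceil>(real m - 3) / real r\<rceil> + (r - 2))) \<and>
     (\<forall>m::nat. (12 \<le> m \<longrightarrow> ell_ones m 2 1 = enat (nat \<lfloor>real m / 2\<rfloor>)) \<and>
               (10 \<le> m \<and> m mod 3 \<noteq> 2 \<longrightarrow> ell_ones m 3 2 = enat (m - 2)) \<and>
               (14 \<le> m \<and> m mod 3 = 2 \<longrightarrow> ell_ones m 3 2 = enat ((2 * m - 4) div 3)) \<and>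
               (62 \<le> m \<longrightarrow> ell_ones m 4 3 = enat (nat \<lceil>(real m - 2) / 4\<rceil> + 2)))"
proof (intro conjI allI impI)
  fix m :: nat
  show "9 \<le> m \<Longrightarrow> ell m = enat (m - 4)" by (rule ell_ge_9)
  show "m \<in> {3, 5, 6} \<Longrightarrow> ell m = 3"
    using ell_3 ell_5 ell_6 by (auto simp: numeral_eq_enat)
  show "m \<in> {4, 7, 8} \<Longrightarrow> ell m = 4"
    using ell_4 ell_7 ell_8 by (auto simp: numeral_eq_enat)
  show "ell_ones m 2 1 = enat (nat \<lfloor>real m / 2\<rfloor>)" if "12 \<le> m"
  proof -
    have "\<lfloor>real m / 2\<rfloor> = int m div 2" using floor_divide_of_nat_eq[of m 2] by (simp add: zdiv_int)
    then have "nat \<lfloor>real m / 2\<rfloor> = 1 + (m div 2 - 1)" using that by (simp add: nat_div_distrib)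
    moreover have "ell_ones m 2 1 = enat (1 + (m div 2 - 1))"
      by (rule ell_ones_2) (use that in linarith)+
    ultimately show ?thesis by simp
  qed
  show "ell_ones m 3 2 = enat (m - 2)" if "10 \<le> m \<and> m mod 3 \<noteq> 2"
  proof -
    have "2 + (m - 4) = m - 2" using that by linarith
    then show ?thesis using ell_ones_3[of m] that by metis
  qed
  show "ell_ones m 3 2 = enat ((2 * m - 4) div 3)" if "14 \<le> m \<and> m mod 3 = 2"
  proof -
    define d where "d = m div 3"
    have m: "m = 3 * d + 2" using that mult_div_mod_eq[of 3 m] by (simp add: d_def)
    have "ell_ones m 3 2 = enat (2 + (2 * d - 2))"
      by (rule ell_ones_3_mod_2[of m "int d"]) (use m that in linarith)+
    moreover have "2 + (2 * d - 2) = (2 * m - 4) div 3" using m that by linarith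
    ultimately show ?thesis by metis
  qed
  show "62 \<le> m \<Longrightarrow> ell_ones m 4 3 = enat (nat \<lceil>(real m - 2) / 4\<rceil> + 2)" by (rule ell_ones_4_ceiling)
next
  fix m r :: nat
  assume "5 \<le> r \<and> r < m - 3"
  then show "ell_ones m r (r - 1) = enat (nat \<lceil>(real m - 3) / real r\<rceil> + (r - 2))"
    by (intro ell_ones_ge_5_ceiling) auto
qed

end
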